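(* Let $T$ be a linear operator in $H$ with associated quadratic form $t[x]:=\langle Tx,x\rangle$, $\operatorname{dom}(t)=\operatorname{dom}(T)$, let $t^*$ be the adjoint form ($t^*[x,y]=\overline{t[y,x]}$), and let $\operatorname{Re}t:=\frac12(t+t^* )$, $\operatorname{Im}t:=\frac1{2\mathrm i}(t-t^* )$. (i) $\operatorname{Re}W_e(T)\subset W_e(\operatorname{Re}t)$ and $\operatorname{Im}W_e(T)\subset W_e(\operatorname{Im}t)$. (ii) If $T$ is $m$-sectorial with semi-angle $<\pi/2$ and $\operatorname{Re}T$ denotes the selfadjoint operator induced by the (closure of the) symmetric form $\operatorname{Re}t$, then \[ \operatorname{Re}W_e(T)=W_e(\operatorname{Re}T)=\operatorname{conv}\big(\widehat\sigma_e(\operatorname{Re}T)\big)\setminus\{\infty\}; \] in particular, $W_e(T)=\emptyset$ if $T$ has compact resolvent.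
   Context: $H$ is a separable infinite-dimensional complex Hilbert space. For a sesquilinear form $s$ with domain $\operatorname{dom}(s)\subset H$, $W_e(s)=\{\lambda:\exists x_n\in\operatorname{dom}(s),\|x_n\|=1,x_n\stackrel{w}{\to}0,s[x_n]\to\lambda\}$; for an operator, $W_e(T)=W_e(t)$ with $t$ its quadratic form. $T$ is sectorial with semi-angle $\theta\in[0,\pi/2)$ if its numerical range lies in $\{|\arg(\lambda-\gamma)|\le\theta\}$ for some $\gamma\in\mathbb R$; $m$-sectorial if in addition some (hence every) $\lambda\notin\overline{W(T)}$ lies in the resolvent set. $\sigma_e(S)=\{\lambda:\exists x_n\in\operatorname{dom}(S),\|x_n\|=1,x_n\stackrel{w}{\to}0,\|(S-\lambda)x_n\|\to0\}$; for selfadjoint $S$, $\widehat\sigma_e(S)$ is $\sigma_e(S)$ with $+\infty$ (resp. $-\infty$) added if $S$ is unbounded from above (resp. below), and the convex hull is taken in $\mathbb R\cup\{\pm\infty\}$. *)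

theory Defs
  imports "HOL-Analysis.Analysis"
begin

class complex_inner = real_inner + complete_space +
  fixes scaleC :: "complex \<Rightarrow> 'a \<Rightarrow> 'a"
    and cinner :: "'a \<Rightarrow> 'a \<Rightarrow> complex"
  assumes scaleC_add_right: "scaleC a (x + y) = scaleC a x + scaleC a y"
    and scaleC_add_left: "scaleC (a + b) x = scaleC a x + scaleC b x"
    and scaleC_scaleC: "scaleC a (scaleC b x) = scaleC (a * b) x"
    and scaleC_of_real: "scaleC (complex_of_real r) x = scaleR r x"
    and cinner_commute: "cinner x y = cnj (cinner y x)"
    and cinner_add_left: "cinner (x + y) z = cinner x z + cinner y z"
    and cinner_scaleC_left: "cinner (scaleC a x) y = a * cinner x y"
    and Re_cinner: "Re (cinner x y) = inner x y"

definition separable_space :: "'a::complex_inner itself \<Rightarrow> bool" where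
  "separable_space _ \<longleftrightarrow> (\<exists>C::'a set. countable C \<and> closure C = UNIV)"

definition infinite_dimensional :: "'a::complex_inner itself \<Rightarrow> bool" where
  "infinite_dimensional _ \<longleftrightarrow>
     \<not> (\<exists>F::'a set. finite F \<and> (\<forall>x. \<exists>c. x = (\<Sum>v\<in>F. scaleC (c v) v)))"

definition csubspace :: "'a::complex_inner set \<Rightarrow> bool" where
  "csubspace D \<longleftrightarrow> 0 \<in> D \<and> (\<forall>x\<in>D. \<forall>y\<in>D. x + y \<in> D) \<and> (\<forall>a. \<forall>x\<in>D. scaleC a x \<in> D)"

definition lin_op :: "('a::complex_inner \<Rightarrow> 'a) \<Rightarrow> 'a set \<Rightarrow> bool" where
  "lin_op T D \<longleftrightarrow> csubspace D \<and>
     (\<forall>x\<in>D. \<forall>y\<in>D. T (x + y) = T x + T y) \<and> (\<forall>a. \<forall>x\<in>D. T (scaleC a x) = scaleC a (T x))"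

text \<open>Forms are functions of two arguments with a domain; s[x] = s x x.\<close>
definition op_form :: "('a::complex_inner \<Rightarrow> 'a) \<Rightarrow> 'a \<Rightarrow> 'a \<Rightarrow> complex" where
  "op_form T x y = cinner (T x) y"

definition adj_form :: "('a \<Rightarrow> 'a \<Rightarrow> complex) \<Rightarrow> 'a \<Rightarrow> 'a \<Rightarrow> complex" where
  "adj_form t x y = cnj (t y x)"

definition Re_form :: "('a \<Rightarrow> 'a \<Rightarrow> complex) \<Rightarrow> 'a \<Rightarrow> 'a \<Rightarrow> complex" where
  "Re_form t x y = (t x y + adj_form t x y) / 2"

definition Im_form :: "('a \<Rightarrow> 'a \<Rightarrow> complex) \<Rightarrow> 'a \<Rightarrow> 'a \<Rightarrow> complex" where
  "Im_form t x y = (t x y - adj_form t x y) / (2 * \<i>)"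

definition weakly_to_zero :: "(nat \<Rightarrow> 'a::complex_inner) \<Rightarrow> bool" where
  "weakly_to_zero x \<longleftrightarrow> (\<forall>y. (\<lambda>n. cinner (x n) y) \<longlonglongrightarrow> 0)"

definition We_form :: "('a::complex_inner \<Rightarrow> 'a \<Rightarrow> complex) \<Rightarrow> 'a set \<Rightarrow> complex set" where
  "We_form s Ds = {l. \<exists>x. (\<forall>n. x n \<in> Ds \<and> norm (x n) = 1) \<and> weakly_to_zero x
                        \<and> (\<lambda>n. s (x n) (x n)) \<longlonglongrightarrow> l}"

definition We_op :: "('a::complex_inner \<Rightarrow> 'a) \<Rightarrow> 'a set \<Rightarrow> complex set" where
  "We_op T D = We_form (op_form T) D"

definition num_range :: "('a::complex_inner \<Rightarrow> 'a) \<Rightarrow> 'a set \<Rightarrow> complex set" where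
  "num_range T D = {op_form T x x | x. x \<in> D \<and> norm x = 1}"

definition resolvent_set :: "('a::complex_inner \<Rightarrow> 'a) \<Rightarrow> 'a set \<Rightarrow> complex set" where
  "resolvent_set T D = {l. bij_betw (\<lambda>x. T x - scaleC l x) D UNIV \<and>
      (\<exists>C. \<forall>y. norm (inv_into D (\<lambda>x. T x - scaleC l x) y) \<le> C * norm y)}"

definition resolvent :: "('a::complex_inner \<Rightarrow> 'a) \<Rightarrow> 'a set \<Rightarrow> complex \<Rightarrow> 'a \<Rightarrow> 'a" where
  "resolvent T D l = inv_into D (\<lambda>x. T x - scaleC l x)"

definition sectorial :: "('a::complex_inner \<Rightarrow> 'a) \<Rightarrow> 'a set \<Rightarrow> real \<Rightarrow> bool" where
  "sectorial T D \<theta> \<longleftrightarrow> lin_op T D \<and> 0 \<le> \<theta> \<and> \<theta> < pi / 2 \<and>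
     (\<exists>\<gamma>::real. \<forall>z\<in>num_range T D. \<bar>Arg (z - complex_of_real \<gamma>)\<bar> \<le> \<theta>)"

definition m_sectorial :: "('a::complex_inner \<Rightarrow> 'a) \<Rightarrow> 'a set \<Rightarrow> real \<Rightarrow> bool" where
  "m_sectorial T D \<theta> \<longleftrightarrow> sectorial T D \<theta> \<and>
     (\<exists>l. l \<notin> closure (num_range T D) \<and> l \<in> resolvent_set T D)"

definition compact_op :: "('a::complex_inner \<Rightarrow> 'a) \<Rightarrow> bool" where
  "compact_op R \<longleftrightarrow> compact (closure (R ` ball 0 1))"

definition compact_resolvent :: "('a::complex_inner \<Rightarrow> 'a) \<Rightarrow> 'a set \<Rightarrow> bool" where
  "compact_resolvent T D \<longleftrightarrow> (\<exists>l\<in>resolvent_set T D. compact_op (resolvent T D l))"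

definition form_cauchy :: "('a::complex_inner \<Rightarrow> 'a \<Rightarrow> complex) \<Rightarrow> (nat \<Rightarrow> 'a) \<Rightarrow> bool" where
  "form_cauchy s u \<longleftrightarrow>
     (\<forall>e>0. \<exists>N. \<forall>n\<ge>N. \<forall>m\<ge>N. norm (s (u n - u m) (u n - u m)) < e)"

definition form_approx :: "('a::complex_inner \<Rightarrow> 'a \<Rightarrow> complex) \<Rightarrow> 'a set \<Rightarrow> (nat \<Rightarrow> 'a) \<Rightarrow> 'a \<Rightarrow> bool" where
  "form_approx s Ds u x \<longleftrightarrow> (\<forall>n. u n \<in> Ds) \<and> u \<longlonglongrightarrow> x \<and> form_cauchy s u"

definition closure_form_dom :: "('a::complex_inner \<Rightarrow> 'a \<Rightarrow> complex) \<Rightarrow> 'a set \<Rightarrow> 'a set" where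
  "closure_form_dom s Ds = {x. \<exists>u. form_approx s Ds u x}"

definition closure_form :: "('a::complex_inner \<Rightarrow> 'a \<Rightarrow> complex) \<Rightarrow> 'a set \<Rightarrow> 'a \<Rightarrow> 'a \<Rightarrow> complex" where
  "closure_form s Ds x y =
     lim (\<lambda>n. s ((SOME u. form_approx s Ds u x) n) ((SOME v. form_approx s Ds v y) n))"

text \<open>Operator associated with a (densely defined, closed) form s with domain Ds
  (first representation theorem): s[x,y] = <S x, y> for all y in Ds.\<close>
definition assoc_op_dom :: "('a::complex_inner \<Rightarrow> 'a \<Rightarrow> complex) \<Rightarrow> 'a set \<Rightarrow> 'a set" where
  "assoc_op_dom s Ds = {x\<in>Ds. \<exists>z. \<forall>y\<in>Ds. s x y = cinner z y}"

definition assoc_op :: "('a::complex_inner \<Rightarrow> 'a \<Rightarrow> complex) \<Rightarrow> 'a set \<Rightarrow> 'a \<Rightarrow> 'a" where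
  "assoc_op s Ds x = (SOME z. \<forall>y\<in>Ds. s x y = cinner z y)"

definition ReT_dom :: "('a::complex_inner \<Rightarrow> 'a) \<Rightarrow> 'a set \<Rightarrow> 'a set" where
  "ReT_dom T D = assoc_op_dom (closure_form (Re_form (op_form T)) D)
                              (closure_form_dom (Re_form (op_form T)) D)"

definition ReT :: "('a::complex_inner \<Rightarrow> 'a) \<Rightarrow> 'a set \<Rightarrow> 'a \<Rightarrow> 'a" where
  "ReT T D = assoc_op (closure_form (Re_form (op_form T)) D)
                      (closure_form_dom (Re_form (op_form T)) D)"

definition ess_spec :: "('a::complex_inner \<Rightarrow> 'a) \<Rightarrow> 'a set \<Rightarrow> complex set" where
  "ess_spec S D = {l. \<exists>x. (\<forall>n. x n \<in> D \<and> norm (x n) = 1) \<and> weakly_to_zero x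
                        \<and> (\<lambda>n. norm (S (x n) - scaleC l (x n))) \<longlonglongrightarrow> 0}"

definition bounded_above_op :: "('a::complex_inner \<Rightarrow> 'a) \<Rightarrow> 'a set \<Rightarrow> bool" where
  "bounded_above_op S D \<longleftrightarrow> (\<exists>M. \<forall>x\<in>D. Re (cinner (S x) x) \<le> M * (norm x)\<^sup>2)"

definition bounded_below_op :: "('a::complex_inner \<Rightarrow> 'a) \<Rightarrow> 'a set \<Rightarrow> bool" where
  "bounded_below_op S D \<longleftrightarrow> (\<exists>M. \<forall>x\<in>D. M * (norm x)\<^sup>2 \<le> Re (cinner (S x) x))"

text \<open>Extended essential spectrum of a selfadjoint operator, in the extended reals.\<close>
definition ess_spec_hat :: "('a::complex_inner \<Rightarrow> 'a) \<Rightarrow> 'a set \<Rightarrow> ereal set" where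
  "ess_spec_hat S D =
     ereal ` {r. complex_of_real r \<in> ess_spec S D}
     \<union> (if bounded_above_op S D then {} else {\<infinity>})
     \<union> (if bounded_below_op S D then {} else {-\<infinity>})"

definition ereal_conv :: "ereal set \<Rightarrow> ereal set" where
  "ereal_conv A = {x. \<exists>a\<in>A. \<exists>b\<in>A. a \<le> x \<and> x \<le> b}"

end

theory Submission
  imports Defs
begin

text \<open>All forms are shifted and replaced by their real parts, so that they become real, symmetric and
  bounded below by the squared norm. Since the imaginary part of a sectorial form is controlled by its
  real part, \<open>Re (W\<^sub>e(T))\<close> is the essential numerical range of \<open>Re t\<close>; as both \<open>dom(T)\<close> and
  \<open>dom(Re T)\<close> are form cores of the closure, it equals \<open>W\<^sub>e(Re T)\<close>. The latter is a closed interval.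
  A finite endpoint \<open>L\<close> lies in the essential spectrum: for a singular sequence \<open>x\<close> realizing \<open>L\<close>
  the correction \<open>x - L A\<^sup>-\<^sup>1 x\<close> is a gradient direction of an extremal problem and tends to zero.
  Conversely, combinations of asymptotically orthogonal singular sequences fill the interval between
  two essential spectral points, and unboundedness from above fills the rest of a half line. No spectral
  theorem is needed.\<close>

section \<open>Symmetric forms bounded below by the squared norm\<close>

text \<open>Real scalars are enough because the imaginary part of a complex form at (x, y) is its
  real part at (x, i y), and \<open>D\<close> and \<open>clV\<close> are stable under i;
  representation and projection arguments then need no conjugation. The shift is chosen with lower
  bound one: the form norm dominates the norm, and the shifted operator gets an everywhere defined
  symmetric inverse of norm at most one. The main obstacle is that \<open>Re t\<close> need not come
  from an operator on dom(T): the adjoint of T may live on another domain. Closability therefore has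
  to be extracted from t itself, whose modulus sectoriality bounds by its real part. Nor is density
  of dom(T) among the assumptions; a resolvent point outside the closed numerical range supplies it
  as totality, which makes the associated operator unique. The two endpoints are not symmetric:
  vectors tending to zero have nonnegative form values, but without an upper bound these values may
  stay away from zero. Hence the extremal argument carries a sign and, for the upper endpoint, a
  bound on the form.\<close>

locale posform =
  fixes V :: "'a::{real_inner,complete_space} set" and B :: "'a \<Rightarrow> 'a \<Rightarrow> real"
  assumes subspace_V: "subspace V"
    and B_add_left: "\<lbrakk>x \<in> V; y \<in> V; z \<in> V\<rbrakk> \<Longrightarrow> B (x + y) z = B x z + B y z"
    and B_scale_left: "\<lbrakk>x \<in> V; y \<in> V\<rbrakk> \<Longrightarrow> B (c *\<^sub>R x) y = c * B x y"
    and B_sym: "\<lbrakk>x \<in> V; y \<in> V\<rbrakk> \<Longrightarrow> B x y = B y x"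
    and B_coercive: "x \<in> V \<Longrightarrow> (norm x)\<^sup>2 \<le> B x x"
begin

lemmas V_closed [simp, intro] =
  subspace_0[OF subspace_V] subspace_add[OF subspace_V] subspace_diff[OF subspace_V]
  subspace_scale[OF subspace_V] subspace_neg[OF subspace_V]

lemma B_add_right: "\<lbrakk>x \<in> V; y \<in> V; z \<in> V\<rbrakk> \<Longrightarrow> B x (y + z) = B x y + B x z"
  by (metis B_add_left B_sym V_closed(2))

lemma B_scale_right: "\<lbrakk>x \<in> V; y \<in> V\<rbrakk> \<Longrightarrow> B x (c *\<^sub>R y) = c * B x y"
  by (metis B_scale_left B_sym V_closed(4))

lemma B_diff_left: "\<lbrakk>x \<in> V; y \<in> V; z \<in> V\<rbrakk> \<Longrightarrow> B (x - y) z = B x z - B y z"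
  using B_add_left[of x "(-1) *\<^sub>R y" z] B_scale_left[of y z "-1"] by simp

lemma B_diff_right: "\<lbrakk>x \<in> V; y \<in> V; z \<in> V\<rbrakk> \<Longrightarrow> B x (y - z) = B x y - B x z"
  by (metis B_diff_left B_sym V_closed(3))

lemmas B_bilinear = B_add_left B_add_right B_diff_left B_diff_right B_scale_left B_scale_right

lemma B_nonneg: "x \<in> V \<Longrightarrow> 0 \<le> B x x"
  using B_coercive[of x] by (meson order_trans zero_le_power2)

definition nB :: "'a \<Rightarrow> real" where "nB x = sqrt (B x x)"

lemma nB_nonneg [simp]: "x \<in> V \<Longrightarrow> 0 \<le> nB x"
  by (simp add: nB_def B_nonneg)

lemma nB_square: "x \<in> V \<Longrightarrow> (nB x)\<^sup>2 = B x x"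
  by (simp add: nB_def B_nonneg)

lemma norm_le_nB: "x \<in> V \<Longrightarrow> norm x \<le> nB x"
  by (simp add: nB_def B_coercive real_le_rsqrt)

lemma nB_scale: "x \<in> V \<Longrightarrow> nB (c *\<^sub>R x) = \<bar>c\<bar> * nB x"
  by (simp add: nB_def B_bilinear real_sqrt_mult flip: mult.assoc)

lemma nB_minus_commute: "\<lbrakk>x \<in> V; y \<in> V\<rbrakk> \<Longrightarrow> nB (x - y) = nB (y - x)"
  using nB_scale[of "y - x" "-1"] by simp

lemma Cauchy_Schwarz:
  assumes "x \<in> V" "y \<in> V"
  shows "\<bar>B x y\<bar> \<le> nB x * nB y"
proof -
  have "(B x y)\<^sup>2 \<le> B x x * B y y"
  proof (cases "y = 0")
    case True
    then show ?thesis using B_scale_left[of y x 0] B_sym[of x y] assms B_scale_left[of y y 0]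
      by simp
  next
    case False
    then have "0 < (norm y)\<^sup>2" by simp
    with B_coercive[OF assms(2)] have pos: "0 < B y y" by linarith
    let ?c = "B x y / B y y"
    have "0 \<le> B (x - ?c *\<^sub>R y) (x - ?c *\<^sub>R y)" using assms by (intro B_nonneg) auto
    also have "\<dots> = B x x - (B x y)\<^sup>2 / B y y"
      using assms pos B_sym[OF assms]
      by (simp add: B_bilinear field_simps power2_eq_square)
    finally show ?thesis using pos by (simp add: field_simps)
  qed
  then have "sqrt ((B x y)\<^sup>2) \<le> sqrt (B x x * B y y)" by (rule real_sqrt_le_mono)
  then show ?thesis by (simp add: nB_def real_sqrt_mult)
qed

lemma nB_triangle:
  assumes "x \<in> V" "y \<in> V"
  shows "nB (x + y) \<le> nB x + nB y"
proof -
  have "(nB (x + y))\<^sup>2 = (nB x)\<^sup>2 + 2 * B x y + (nB y)\<^sup>2"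
    using assms B_sym[OF assms] by (simp add: nB_square B_bilinear)
  also have "\<dots> \<le> (nB x + nB y)\<^sup>2"
    using Cauchy_Schwarz[OF assms] by (simp add: power2_sum)
  finally show ?thesis using assms by (meson nB_nonneg add_nonneg_nonneg power2_le_imp_le)
qed

lemma nB_triangle_diff:
  assumes "x \<in> V" "y \<in> V" "z \<in> V"
  shows "nB (x - z) \<le> nB (x - y) + nB (y - z)"
  using nB_triangle[of "x - y" "y - z"] assms by simp

lemma B_tendsto_self:
  assumes "\<And>n. u n \<in> V" "x \<in> V" "(\<lambda>n. nB (u n - x)) \<longlonglongrightarrow> 0"
  shows "(\<lambda>n. B (u n) (u n)) \<longlonglongrightarrow> B x x"
proof -
  have "\<bar>nB (u n) - nB x\<bar> \<le> nB (u n - x)" for n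
    using nB_triangle[of "u n - x" x] nB_triangle[of "x - u n" "u n"] nB_minus_commute[of "u n" x]
      assms(1)[of n] assms(2) by simp
  then have "(\<lambda>n. nB (u n) - nB x) \<longlonglongrightarrow> 0"
    by (intro Lim_null_comparison[OF _ assms(3)] always_eventually) simp
  then have "(\<lambda>n. (nB (u n))\<^sup>2) \<longlonglongrightarrow> (nB x)\<^sup>2"
    by (intro tendsto_power) (simp add: LIM_zero_iff)
  then show ?thesis by (simp add: nB_square assms)
qed

text \<open>Stated with the quadratic form instead of its root, so that it can be compared directly
  with \<open>form_cauchy\<close>; \<open>cauchy_nB\<close> is the version for the form
  norm.\<close>

definition cauchy :: "(nat \<Rightarrow> 'a) \<Rightarrow> bool" where
  "cauchy u \<longleftrightarrow> (\<forall>e>0. \<exists>N. \<forall>n\<ge>N. \<forall>m\<ge>N. B (u n - u m) (u n - u m) < e)"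

lemma cauchy_nB:
  assumes "\<And>n. u n \<in> V"
  shows "cauchy u \<longleftrightarrow> (\<forall>e>0. \<exists>N. \<forall>n\<ge>N. \<forall>m\<ge>N. nB (u n - u m) < e)"
proof
  assume c: "cauchy u"
  show "\<forall>e>0. \<exists>N. \<forall>n\<ge>N. \<forall>m\<ge>N. nB (u n - u m) < e"
  proof (intro allI impI)
    fix e :: real assume e: "e > 0"
    then obtain N where N: "\<And>n m. n \<ge> N \<Longrightarrow> m \<ge> N \<Longrightarrow> B (u n - u m) (u n - u m) < e\<^sup>2"
      using c unfolding cauchy_def by (meson zero_less_power)
    have "nB (u n - u m) < e" if "n \<ge> N" "m \<ge> N" for n m
      using N[OF that] e unfolding nB_def
      by (metis less_imp_le real_sqrt_less_mono real_sqrt_unique)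
    then show "\<exists>N. \<forall>n\<ge>N. \<forall>m\<ge>N. nB (u n - u m) < e" by blast
  qed
next
  assume r: "\<forall>e>0. \<exists>N. \<forall>n\<ge>N. \<forall>m\<ge>N. nB (u n - u m) < e"
  show "cauchy u" unfolding cauchy_def
  proof (intro allI impI)
    fix e :: real assume e: "e > 0"
    then obtain N where N: "\<And>n m. n \<ge> N \<Longrightarrow> m \<ge> N \<Longrightarrow> nB (u n - u m) < sqrt e"
      using r by (meson real_sqrt_gt_zero)
    have "B (u n - u m) (u n - u m) < e" if "n \<ge> N" "m \<ge> N" for n m
      using N[OF that] unfolding nB_def by simp
    then show "\<exists>N. \<forall>n\<ge>N. \<forall>m\<ge>N. B (u n - u m) (u n - u m) < e" by blast
  qed
qed

lemma cauchy_imp_Cauchy: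
  assumes "\<And>n. u n \<in> V" "cauchy u"
  shows "Cauchy u"
proof (rule metric_CauchyI)
  fix e :: real assume "e > 0"
  then obtain N where N: "\<And>n m. n \<ge> N \<Longrightarrow> m \<ge> N \<Longrightarrow> nB (u n - u m) < e"
    using assms(2) unfolding cauchy_nB[OF assms(1)] by meson
  have "dist (u m) (u n) < e" if "m \<ge> N" "n \<ge> N" for m n
    using norm_le_nB[of "u m - u n"] N[OF that] assms(1) by (simp add: dist_norm)
  then show "\<exists>M. \<forall>m\<ge>M. \<forall>n\<ge>M. dist (u m) (u n) < e" by blast
qed

end

section \<open>Complete forms, Riesz representation and the associated operator\<close>

locale closed_posform = posform +
  assumes complete: "\<lbrakk>\<And>n. u n \<in> V; cauchy u\<rbrakk> \<Longrightarrow> \<exists>x\<in>V. (\<lambda>n. nB (u n - x)) \<longlonglongrightarrow> 0"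
begin

text \<open>The subspace \<open>R\<close> need not be closed: the minimizer of \<open>B v v - 2 f v\<close> over \<open>R\<close> is a limit
  of elements of \<open>R\<close>. With \<open>R = V\<close> this is the Riesz representation theorem, and with
  \<open>f v = B x v\<close> it is the orthogonal projection onto the closure of \<open>R\<close>.\<close>

lemma riesz_subspace:
  assumes R: "subspace R" "R \<subseteq> V"
    and f_add: "\<And>x y. x \<in> V \<Longrightarrow> y \<in> V \<Longrightarrow> f (x + y) = f x + f y"
    and f_scale: "\<And>c x. x \<in> V \<Longrightarrow> f (c *\<^sub>R x) = c * f x"
    and f_bound: "\<And>x. x \<in> V \<Longrightarrow> \<bar>f x\<bar> \<le> C * nB x"
  obtains p g where "p \<in> V" "\<And>n::nat. g n \<in> R" "(\<lambda>n. nB (g n - p)) \<longlonglongrightarrow> 0"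
    "\<And>v. v \<in> R \<Longrightarrow> B p v = f v"
proof -
  define J where "J v = B v v - 2 * f v" for v
  have J_low: "J v \<ge> - C\<^sup>2" if "v \<in> V" for v
  proof -
    have "J v \<ge> (nB v)\<^sup>2 - 2 * (C * nB v)"
      using f_bound[OF that] nB_square[OF that] by (simp add: J_def)
    moreover have "(nB v)\<^sup>2 - 2 * (C * nB v) + C\<^sup>2 = (nB v - C)\<^sup>2"
      by (simp add: power2_eq_square algebra_simps)
    ultimately show ?thesis using zero_le_power2[of "nB v - C"] by linarith
  qed
  define d where "d = Inf (J ` R)"
  have bdd: "bdd_below (J ` R)" using J_low R(2) by (meson bdd_belowI2 subsetD)
  have ne: "J ` R \<noteq> {}" using subspace_0[OF R(1)] by blast
  have d_le: "d \<le> J v" if "v \<in> R" for v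
    unfolding d_def using bdd that by (simp add: cInf_lower)
  have "\<exists>v\<in>R. J v < d + 1 / real (Suc n)" for n
    using cInf_lessD[OF ne, of "d + 1 / real (Suc n)"] unfolding d_def by auto
  then obtain g where g: "\<And>n. g n \<in> R" "\<And>n. J (g n) < d + 1 / real (Suc n)" by metis
  have gV: "g n \<in> V" for n using g(1) R(2) by blast
  \<comment> \<open>The parallelogram identity for \<open>J\<close>: the midpoint stays in
    \<open>R\<close>, where \<open>J\<close> is at least \<open>d\<close>, so two near-minimizers
    are close in the form norm.\<close>
  have para: "J u + J v = 2 * J ((1/2) *\<^sub>R (u + v)) + B (u - v) (u - v) / 2"
    if "u \<in> V" "v \<in> V" for u v
    using that f_add[OF that] f_scale[of "u + v" "1/2"] B_sym[OF that]
    by (simp add: J_def B_bilinear field_simps)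
  have "cauchy g" unfolding cauchy_def
  proof (intro allI impI)
    fix e :: real assume e: "e > 0"
    obtain N where N: "1 / real (Suc N) < e / 4" using nat_approx_posE[of "e/4"] e by auto
    have "B (g n - g m) (g n - g m) < e" if "n \<ge> N" "m \<ge> N" for n m
    proof -
      have "1 / real (Suc n) \<le> 1 / real (Suc N)" "1 / real (Suc m) \<le> 1 / real (Suc N)"
        using that by (auto simp: field_simps)
      moreover have "d \<le> J ((1/2) *\<^sub>R (g n + g m))"
        using d_le g(1) R(1) by (metis subspace_add subspace_scale)
      ultimately show ?thesis using para[OF gV gV, of n m] g(2)[of n] g(2)[of m] N by linarith
    qed
    then show "\<exists>N. \<forall>n\<ge>N. \<forall>m\<ge>N. B (g n - g m) (g n - g m) < e" by blast
  qed
  then obtain p where p: "p \<in> V" "(\<lambda>n. nB (g n - p)) \<longlonglongrightarrow> 0"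
    using complete[of g] gV by blast
  have f_diff: "f x - f y = f (x - y)" if "x \<in> V" "y \<in> V" for x y
    using f_add[of "x - y" y] that by simp
  have J_cont: "(\<lambda>n. J (g n + w)) \<longlonglongrightarrow> J (p + w)" if w: "w \<in> V" for w
  proof -
    have l: "(\<lambda>n. nB (g n + w - (p + w))) \<longlonglongrightarrow> 0" using p(2) by simp
    then have l': "(\<lambda>n. C * nB (g n + w - (p + w))) \<longlonglongrightarrow> 0"
      by (rule tendsto_mult_right_zero)
    have "norm (f (g n + w) - f (p + w)) \<le> C * nB (g n + w - (p + w))" for n
    proof -
      have "g n + w \<in> V" "p + w \<in> V" using gV p(1) w by auto
      then show ?thesis using f_bound f_diff V_closed(3) by (metis real_norm_def)
    qed
    then have "(\<lambda>n. f (g n + w) - f (p + w)) \<longlonglongrightarrow> 0"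
      by (intro Lim_null_comparison[OF _ l'] always_eventually) blast
    then have "(\<lambda>n. f (g n + w)) \<longlonglongrightarrow> f (p + w)" by (simp add: LIM_zero_iff)
    moreover have "(\<lambda>n. B (g n + w) (g n + w)) \<longlonglongrightarrow> B (p + w) (p + w)"
      using B_tendsto_self[OF _ _ l] gV p(1) w by blast
    ultimately show ?thesis unfolding J_def by (intro tendsto_intros)
  qed
  have Jp: "J p \<le> d"
  proof (rule LIMSEQ_le)
    show "(\<lambda>n. J (g n)) \<longlonglongrightarrow> J p" using J_cont[of 0] by simp
    show "(\<lambda>n. d + 1 / real (Suc n)) \<longlonglongrightarrow> d"
      using tendsto_add[OF tendsto_const LIMSEQ_Suc[OF lim_1_over_n], of d] by simp
    show "\<exists>N. \<forall>n\<ge>N. J (g n) \<le> d + 1 / real (Suc n)" using g(2) less_imp_le by blast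
  qed
  have "B p v = f v" if v: "v \<in> R" for v
  proof (rule ccontr)
    assume ne: "B p v \<noteq> f v"
    have vV: "v \<in> V" using v R(2) by blast
    \<comment> \<open>The limit \<open>p\<close> may lie outside \<open>R\<close>, so minimality is
      first used at \<open>g n + c *\<^sub>R v\<close> and then passed to the limit.\<close>
    have ge: "d \<le> J (p + c *\<^sub>R v)" for c
    proof (rule LIMSEQ_le_const)
      show "(\<lambda>n. J (g n + c *\<^sub>R v)) \<longlonglongrightarrow> J (p + c *\<^sub>R v)" using J_cont vV by blast
      show "\<exists>N. \<forall>n\<ge>N. d \<le> J (g n + c *\<^sub>R v)"
        using d_le g(1) v R(1) by (meson subspace_add subspace_scale)
    qed
    have expand: "J (p + c *\<^sub>R v) = J p + 2 * c * (B p v - f v) + c\<^sup>2 * B v v" for c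
      using p(1) vV B_sym[OF p(1) vV] f_add[of p "c *\<^sub>R v"] f_scale[OF vV]
      by (simp add: J_def B_bilinear power2_eq_square algebra_simps)
    define a where "a = B p v - f v"
    \<comment> \<open>The optimal step is \<open>- a / B v v\<close>; adding one to the denominator
      avoids showing that \<open>B v v\<close> is positive and still makes \<open>J\<close>
      decrease.\<close>
    define K where "K = 1 + B v v"
    have K: "K > 0" "B v v \<le> K" using B_nonneg[OF vV] by (auto simp: K_def)
    have "0 \<le> 2 * (- a / K) * a + (- a / K)\<^sup>2 * B v v"
      using ge[of "- a / K"] expand[of "- a / K"] Jp by (simp add: a_def)
    also have "\<dots> \<le> 2 * (- a / K) * a + (- a / K)\<^sup>2 * K"
      using K(2) by (intro add_left_mono mult_left_mono) auto
    also have "\<dots> = - a\<^sup>2 / K" using K by (simp add: field_simps power2_eq_square)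
    also have "\<dots> < 0" using K ne by (simp add: a_def)
    finally show False by simp
  qed
  with p g(1) show ?thesis by (intro that[of p g])
qed

lemma riesz:
  assumes "\<And>x y. x \<in> V \<Longrightarrow> y \<in> V \<Longrightarrow> f (x + y) = f x + f y"
    and "\<And>c x. x \<in> V \<Longrightarrow> f (c *\<^sub>R x) = c * f x"
    and "\<And>x. x \<in> V \<Longrightarrow> \<bar>f x\<bar> \<le> C * nB x"
  shows "\<exists>p\<in>V. \<forall>v\<in>V. B p v = f v"
  by (rule riesz_subspace[of V f C]) (use assms subspace_V in auto)

text \<open>Domain of the operator of the first representation theorem. Only existence of the
  representing vector is recorded: uniqueness would require \<open>V\<close> to be total.\<close>

definition op_dom :: "'a set" where
  "op_dom = {x \<in> V. \<exists>z. \<forall>v\<in>V. B x v = inner z v}"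

text \<open>Surjectivity of the associated operator. The form norm dominates the norm, so
  \<open>inner h\<close> is a bounded functional for it and Riesz applies.\<close>

lemma ex_op_dom: "\<exists>x\<in>op_dom. \<forall>v\<in>V. B x v = inner h v"
proof -
  have "\<bar>inner h x\<bar> \<le> norm h * nB x" if "x \<in> V" for x
    using Cauchy_Schwarz_ineq2[of h x] norm_le_nB[OF that]
    by (meson mult_left_mono norm_ge_zero order_trans)
  then obtain p where "p \<in> V" "\<forall>v\<in>V. B p v = inner h v"
    using riesz[of "inner h" "norm h"] by (auto simp: inner_add_right)
  then show ?thesis unfolding op_dom_def by blast
qed

lemma op_dom_subset: "op_dom \<subseteq> V"
  by (auto simp: op_dom_def)

lemma subspace_op_dom: "subspace op_dom"
proof (rule subspaceI)
  show "0 \<in> op_dom"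
    using B_scale_left[of 0 _ 0] unfolding op_dom_def by (auto intro!: exI[of _ 0])
next
  fix x y assume "x \<in> op_dom" "y \<in> op_dom"
  then obtain z w where "x \<in> V" "y \<in> V" "\<forall>v\<in>V. B x v = inner z v" "\<forall>v\<in>V. B y v = inner w v"
    unfolding op_dom_def by blast
  then have "x + y \<in> V" "\<forall>v\<in>V. B (x + y) v = inner (z + w) v"
    by (auto simp: B_bilinear inner_add_left)
  then show "x + y \<in> op_dom" unfolding op_dom_def by blast
next
  fix x and c :: real assume "x \<in> op_dom"
  then obtain z where "x \<in> V" "\<forall>v\<in>V. B x v = inner z v"
    unfolding op_dom_def by blast
  then have "c *\<^sub>R x \<in> V" "\<forall>v\<in>V. B (c *\<^sub>R x) v = inner (c *\<^sub>R z) v"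
    by (auto simp: B_bilinear)
  then show "c *\<^sub>R x \<in> op_dom" unfolding op_dom_def by blast
qed

text \<open>A vector orthogonal to \<open>op_dom\<close> in the form inner product is orthogonal to the whole space
  in the original one.\<close>

lemma op_dom_dense:
  assumes "x \<in> V"
  shows "\<exists>g. (\<forall>n::nat. g n \<in> op_dom) \<and> (\<lambda>n. nB (g n - x)) \<longlonglongrightarrow> 0"
proof -
  obtain p g where p: "p \<in> V" "\<And>n::nat. g n \<in> op_dom" "(\<lambda>n. nB (g n - p)) \<longlonglongrightarrow> 0"
    "\<And>v. v \<in> op_dom \<Longrightarrow> B p v = B x v"
    by (rule riesz_subspace[of op_dom "B x" "nB x"])
      (use assms subspace_op_dom op_dom_subset Cauchy_Schwarz in \<open>auto simp: B_bilinear\<close>)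
  obtain w where w: "w \<in> op_dom" "\<forall>v\<in>V. B w v = inner (x - p) v"
    using ex_op_dom by blast
  have wV: "w \<in> V" using w(1) op_dom_subset by blast
  have "inner (x - p) (x - p) = B w (x - p)" using w(2) assms p(1) by auto
  also have "\<dots> = 0"
    using p(4)[OF w(1)] assms p(1) wV B_sym[OF wV] by (simp add: B_bilinear)
  finally have "x = p" by simp
  with p show ?thesis by blast
qed

end

section \<open>Closure of a form\<close>

locale closable_posform = posform +
  assumes closable:
    "\<lbrakk>\<And>n. u n \<in> V; u \<longlonglongrightarrow> 0; cauchy u\<rbrakk> \<Longrightarrow> (\<lambda>n. B (u n) (u n)) \<longlonglongrightarrow> 0"
begin

definition approx :: "(nat \<Rightarrow> 'a) \<Rightarrow> 'a \<Rightarrow> bool" where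
  "approx u x \<longleftrightarrow> (\<forall>n. u n \<in> V) \<and> u \<longlonglongrightarrow> x \<and> cauchy u"

definition clV :: "'a set" where "clV = {x. \<exists>u. approx u x}"

text \<open>Mirrors \<open>closure_form\<close>, including the choice of the approximating
  sequences; \<open>clB_tendsto\<close> removes the dependence on that choice.\<close>

definition clB :: "'a \<Rightarrow> 'a \<Rightarrow> real" where
  "clB x y = lim (\<lambda>n. B ((SOME u. approx u x) n) ((SOME v. approx v y) n))"

lemma approx_in: "approx u x \<Longrightarrow> u n \<in> V"
  by (simp add: approx_def)

lemma approx_add:
  assumes "approx u x" "approx v y"
  shows "approx (\<lambda>n. u n + v n) (x + y)"
proof -
  have V: "u n \<in> V" "v n \<in> V" for n using assms approx_in by auto
  have "cauchy (\<lambda>n. u n + v n)"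
  proof (subst cauchy_nB; (intro allI impI)?)
    fix e :: real assume e: "e > 0"
    have "cauchy u" "cauchy v" using assms by (auto simp: approx_def)
    then obtain N M where N: "\<And>n m. n \<ge> N \<Longrightarrow> m \<ge> N \<Longrightarrow> nB (u n - u m) < e / 2"
        "\<And>n m. n \<ge> M \<Longrightarrow> m \<ge> M \<Longrightarrow> nB (v n - v m) < e / 2"
      unfolding cauchy_nB[OF V(1)] cauchy_nB[OF V(2)] using e by (meson half_gt_zero)
    have "nB (u n + v n - (u m + v m)) < e" if "n \<ge> max N M" "m \<ge> max N M" for n m
    proof -
      have "nB ((u n - u m) + (v n - v m)) \<le> nB (u n - u m) + nB (v n - v m)"
        using V by (intro nB_triangle) auto
      also have "\<dots> < e" using N(1)[of n m] N(2)[of n m] that by auto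
      finally show ?thesis by (simp add: algebra_simps)
    qed
    then show "\<exists>N. \<forall>n\<ge>N. \<forall>m\<ge>N. nB (u n + v n - (u m + v m)) < e" by blast
  qed (use V in auto)
  moreover have "(\<lambda>n. u n + v n) \<longlonglongrightarrow> x + y"
    using assms by (intro tendsto_add) (auto simp: approx_def)
  ultimately show ?thesis using V by (simp add: approx_def)
qed

lemma approx_scale:
  assumes "approx u x"
  shows "approx (\<lambda>n. c *\<^sub>R u n) (c *\<^sub>R x)"
proof -
  have V: "u n \<in> V" for n using assms approx_in by auto
  have "cauchy (\<lambda>n. c *\<^sub>R u n)"
  proof (subst cauchy_nB; (intro allI impI)?)
    fix e :: real assume e: "e > 0"
    have "cauchy u" using assms by (auto simp: approx_def)
    moreover have "e / (\<bar>c\<bar> + 1) > 0" using e by (simp add: add_nonneg_pos)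
    ultimately obtain N
      where N: "\<And>n m. n \<ge> N \<Longrightarrow> m \<ge> N \<Longrightarrow> nB (u n - u m) < e / (\<bar>c\<bar> + 1)"
      unfolding cauchy_nB[OF V] by meson
    have "nB (c *\<^sub>R u n - c *\<^sub>R u m) < e" if "n \<ge> N" "m \<ge> N" for n m
    proof -
      have "nB (c *\<^sub>R u n - c *\<^sub>R u m) = \<bar>c\<bar> * nB (u n - u m)"
        using V by (simp add: nB_scale flip: scaleR_diff_right)
      also have "\<dots> \<le> (\<bar>c\<bar> + 1) * nB (u n - u m)"
        using V by (intro mult_right_mono) auto
      also have "\<dots> < e" using N[OF that] by (simp add: field_simps)
      finally show ?thesis .
    qed
    then show "\<exists>N. \<forall>n\<ge>N. \<forall>m\<ge>N. nB (c *\<^sub>R u n - c *\<^sub>R u m) < e" by blast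
  qed (use V in auto)
  moreover have "(\<lambda>n. c *\<^sub>R u n) \<longlonglongrightarrow> c *\<^sub>R x"
    using assms by (intro tendsto_scaleR tendsto_const) (auto simp: approx_def)
  ultimately show ?thesis using V by (simp add: approx_def)
qed

lemma approx_diff:
  assumes "approx u x" "approx v y"
  shows "approx (\<lambda>n. u n - v n) (x - y)"
  using approx_add[OF assms(1) approx_scale[OF assms(2), of "-1"]] by simp

lemma approx_const: "x \<in> V \<Longrightarrow> approx (\<lambda>n. x) x"
  using B_scale_left[of 0 0 0] unfolding approx_def cauchy_def by auto

lemma approx_bounded:
  assumes "approx u x"
  obtains C where "\<And>n. nB (u n) \<le> C" "C > 0"
proof -
  have V: "u n \<in> V" for n using assms approx_in by auto
  have "cauchy u" using assms by (auto simp: approx_def)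
  then obtain N where N: "\<And>n m. n \<ge> N \<Longrightarrow> m \<ge> N \<Longrightarrow> nB (u n - u m) < 1"
    unfolding cauchy_nB[OF V] by (meson zero_less_one)
  define C where "C = 1 + nB (u N) + (\<Sum>k<N. nB (u k))"
  have s: "0 \<le> (\<Sum>k<N. nB (u k))" using V by (intro sum_nonneg) auto
  have "nB (u n) \<le> C" for n
  proof (cases "n < N")
    case True
    then have "nB (u n) \<le> (\<Sum>k<N. nB (u k))"
      using V by (intro member_le_sum) auto
    then show ?thesis using nB_nonneg[OF V[of N]] by (simp add: C_def)
  next
    case False
    then show ?thesis
      using N[of n N] nB_triangle[of "u n - u N" "u N"] V s by (simp add: C_def)
  qed
  moreover have "C > 0" using s nB_nonneg[OF V[of N]] by (simp add: C_def)
  ultimately show ?thesis using that by blast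
qed

lemma approx_zero:
  assumes "approx u 0"
  shows "(\<lambda>n. nB (u n)) \<longlonglongrightarrow> 0"
proof -
  have "(\<lambda>n. B (u n) (u n)) \<longlonglongrightarrow> 0" using assms closable by (simp add: approx_def)
  then have "(\<lambda>n. sqrt (B (u n) (u n))) \<longlonglongrightarrow> sqrt 0" by (rule tendsto_real_sqrt)
  then show ?thesis by (simp add: nB_def)
qed

text \<open>Changing one argument at a time reduces the existence of limits of form values, and
  their independence of the sequences, to Cauchy-Schwarz.\<close>

lemma B_diff_bound:
  assumes "x \<in> V" "y \<in> V" "x' \<in> V" "y' \<in> V"
  shows "\<bar>B x y - B x' y'\<bar> \<le> nB (x - x') * nB y + nB x' * nB (y - y')"
proof -
  have "B x y - B x' y' = B (x - x') y + B x' (y - y')" using assms by (simp add: B_bilinear)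
  then show ?thesis
    using Cauchy_Schwarz[of "x - x'" y] Cauchy_Schwarz[of x' "y - y'"] assms by auto
qed

lemma approx_convergent:
  assumes "approx u x" "approx v y"
  shows "convergent (\<lambda>n. B (u n) (v n))"
proof -
  have V: "u n \<in> V" "v n \<in> V" for n using assms approx_in by auto
  obtain C where C: "\<And>n. nB (u n) \<le> C" "C > 0" using approx_bounded[OF assms(1)] by blast
  obtain C' where C': "\<And>n. nB (v n) \<le> C'" "C' > 0" using approx_bounded[OF assms(2)] by blast
  have "Cauchy (\<lambda>n. B (u n) (v n))"
  proof (rule metric_CauchyI)
    fix e :: real assume e: "e > 0"
    have "cauchy u" "cauchy v" using assms by (auto simp: approx_def)
    moreover have "e / (2 * C') > 0" "e / (2 * C) > 0" using C C' e by auto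
    ultimately obtain N M
      where N: "\<And>n m. n \<ge> N \<Longrightarrow> m \<ge> N \<Longrightarrow> nB (u n - u m) < e / (2 * C')"
        "\<And>n m. n \<ge> M \<Longrightarrow> m \<ge> M \<Longrightarrow> nB (v n - v m) < e / (2 * C)"
      unfolding cauchy_nB[OF V(1)] cauchy_nB[OF V(2)] by meson
    have "dist (B (u m) (v m)) (B (u n) (v n)) < e" if "m \<ge> max N M" "n \<ge> max N M" for m n
    proof -
      have 1: "nB (u m - u n) * nB (v m) \<le> nB (u m - u n) * C'"
        using C' V by (intro mult_left_mono) auto
      have 2: "nB (u n) * nB (v m - v n) \<le> C * nB (v m - v n)"
        using C V by (intro mult_right_mono) auto
      have 3: "nB (u m - u n) * C' < e / 2" "C * nB (v m - v n) < e / 2"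
        using N(1)[of m n] N(2)[of m n] that C(2) C'(2) by (auto simp: field_simps)
      have "\<bar>B (u m) (v m) - B (u n) (v n)\<bar> \<le> nB (u m - u n) * nB (v m) + nB (u n) * nB (v m - v n)"
        using V by (intro B_diff_bound)
      with 1 2 3 show ?thesis by (simp add: dist_real_def)
    qed
    then show "\<exists>M. \<forall>m\<ge>M. \<forall>n\<ge>M. dist (B (u m) (v m)) (B (u n) (v n)) < e" by blast
  qed
  then show ?thesis by (simp add: Cauchy_convergent)
qed

text \<open>Here closability enters: the difference of two sequences approximating the same vector
  approximates zero, so its form norm vanishes in the limit.\<close>

lemma approx_independent:
  assumes "approx u x" "approx v y" "approx u' x" "approx v' y"
  shows "(\<lambda>n. B (u n) (v n) - B (u' n) (v' n)) \<longlonglongrightarrow> 0"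
proof -
  have V: "u n \<in> V" "v n \<in> V" "u' n \<in> V" "v' n \<in> V" for n using assms approx_in by auto
  obtain C where C: "\<And>n. nB (v n) \<le> C" "C > 0" using approx_bounded[OF assms(2)] by blast
  obtain C' where C': "\<And>n. nB (u' n) \<le> C'" "C' > 0" using approx_bounded[OF assms(3)] by blast
  have "(\<lambda>n. nB (u n - u' n)) \<longlonglongrightarrow> 0" "(\<lambda>n. nB (v n - v' n)) \<longlonglongrightarrow> 0"
    using approx_zero approx_diff[OF assms(1,3)] approx_diff[OF assms(2,4)] by auto
  then have lim: "(\<lambda>n. nB (u n - u' n) * C + C' * nB (v n - v' n)) \<longlonglongrightarrow> 0"
    by (intro tendsto_add_zero tendsto_mult_left_zero tendsto_mult_right_zero)
  have "norm (B (u n) (v n) - B (u' n) (v' n)) \<le> nB (u n - u' n) * C + C' * nB (v n - v' n)" for n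
  proof -
    have "nB (u n - u' n) * nB (v n) \<le> nB (u n - u' n) * C"
      using C V by (intro mult_left_mono) auto
    moreover have "nB (u' n) * nB (v n - v' n) \<le> C' * nB (v n - v' n)"
      using C' V by (intro mult_right_mono) auto
    moreover have "\<bar>B (u n) (v n) - B (u' n) (v' n)\<bar>
        \<le> nB (u n - u' n) * nB (v n) + nB (u' n) * nB (v n - v' n)"
      using V by (intro B_diff_bound)
    ultimately show ?thesis by simp
  qed
  then show ?thesis by (intro Lim_null_comparison[OF _ lim] always_eventually) blast
qed

lemma clB_tendsto:
  assumes "approx u x" "approx v y"
  shows "(\<lambda>n. B (u n) (v n)) \<longlonglongrightarrow> clB x y"
proof -
  have a: "approx (SOME u. approx u x) x" "approx (SOME v. approx v y) y"
    using someI[of "\<lambda>u. approx u x"] someI[of "\<lambda>v. approx v y"] assms by blast+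
  have "(\<lambda>n. B ((SOME u. approx u x) n) ((SOME v. approx v y) n)) \<longlonglongrightarrow> clB x y"
    unfolding clB_def using approx_convergent[OF a] by (simp add: convergent_LIMSEQ_iff)
  from tendsto_add[OF approx_independent[OF assms a] this] show ?thesis by simp
qed

lemma clB_eqI:
  assumes "approx u x" "approx v y" "(\<lambda>n. B (u n) (v n)) \<longlonglongrightarrow> l"
  shows "clB x y = l"
  using clB_tendsto[OF assms(1,2)] assms(3) LIMSEQ_unique by blast

lemma clB_eq_B: "\<lbrakk>x \<in> V; y \<in> V\<rbrakk> \<Longrightarrow> clB x y = B x y"
  by (rule clB_eqI[OF approx_const approx_const]) auto

lemma V_subset_clV: "V \<subseteq> clV"
  using approx_const by (auto simp: clV_def)

sublocale cl: posform clV clB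
proof
  show "subspace clV"
  proof (rule subspaceI)
    show "0 \<in> clV" using V_subset_clV by auto
  qed (use approx_add approx_scale in \<open>(force simp: clV_def)+\<close>)
next
  fix x y z assume "x \<in> clV" "y \<in> clV" "z \<in> clV"
  then obtain u v w where a: "approx u x" "approx v y" "approx w z" by (auto simp: clV_def)
  then have "u n \<in> V" "v n \<in> V" "w n \<in> V" for n using approx_in by auto
  then have "(\<lambda>n. B (u n + v n) (w n)) \<longlonglongrightarrow> clB x z + clB y z"
    using tendsto_add[OF clB_tendsto[OF a(1,3)] clB_tendsto[OF a(2,3)]] by (simp add: B_bilinear)
  then show "clB (x + y) z = clB x z + clB y z" by (rule clB_eqI[OF approx_add[OF a(1,2)] a(3)])
next
  fix x y c assume "x \<in> clV" "y \<in> clV"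
  then obtain u v where a: "approx u x" "approx v y" by (auto simp: clV_def)
  then have "u n \<in> V" "v n \<in> V" for n using approx_in by auto
  then have "(\<lambda>n. B (c *\<^sub>R u n) (v n)) \<longlonglongrightarrow> c * clB x y"
    using tendsto_mult_left[OF clB_tendsto[OF a], of c] by (simp add: B_bilinear)
  then show "clB (c *\<^sub>R x) y = c * clB x y" by (rule clB_eqI[OF approx_scale[OF a(1)] a(2)])
next
  fix x y assume "x \<in> clV" "y \<in> clV"
  then obtain u v where a: "approx u x" "approx v y" by (auto simp: clV_def)
  then have "B (u n) (v n) = B (v n) (u n)" for n using approx_in B_sym by auto
  then have "(\<lambda>n. B (u n) (v n)) \<longlonglongrightarrow> clB y x"
    using clB_tendsto[OF a(2,1)] by simp
  then show "clB x y = clB y x" by (rule clB_eqI[OF a])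
next
  fix x assume "x \<in> clV"
  then obtain u where a: "approx u x" by (auto simp: clV_def)
  then have lim: "(\<lambda>n. (norm (u n))\<^sup>2) \<longlonglongrightarrow> (norm x)\<^sup>2"
    by (intro tendsto_power tendsto_norm) (simp add: approx_def)
  show "(norm x)\<^sup>2 \<le> clB x x"
    by (rule LIMSEQ_le[OF lim clB_tendsto[OF a a]]) (use B_coercive approx_in[OF a] in blast)
qed

text \<open>For fixed n the vectors \<open>u n - u m\<close> approximate \<open>u n - x\<close> as m
  grows, so the Cauchy bound on \<open>B\<close> passes to \<open>clB\<close> at
  \<open>u n - x\<close>.\<close>

lemma approx_cl_tendsto:
  assumes "approx u x"
  shows "(\<lambda>n. cl.nB (u n - x)) \<longlonglongrightarrow> 0"
proof (rule LIMSEQ_I)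
  have V: "u n \<in> V" for n using assms approx_in by auto
  fix e :: real assume e: "e > 0"
  have "cauchy u" using assms by (simp add: approx_def)
  then obtain N where N: "\<And>n m. n \<ge> N \<Longrightarrow> m \<ge> N \<Longrightarrow> B (u n - u m) (u n - u m) < (e/2)\<^sup>2"
    using e unfolding cauchy_def by (meson half_gt_zero zero_less_power)
  have "norm (cl.nB (u n - x) - 0) < e" if n: "n \<ge> N" for n
  proof -
    have a: "approx (\<lambda>m. u n - u m) (u n - x)"
      using approx_diff[OF approx_const[OF V] assms] .
    have "clB (u n - x) (u n - x) \<le> (e/2)\<^sup>2"
      by (rule LIMSEQ_le_const2[OF clB_tendsto[OF a a]]) (use N n less_imp_le in blast)
    then have "cl.nB (u n - x) \<le> e / 2" unfolding cl.nB_def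
      using e by (intro real_le_lsqrt) auto
    moreover have "u n - x \<in> clV" using a by (auto simp: clV_def)
    ultimately show ?thesis using e by simp
  qed
  then show "\<exists>N. \<forall>n\<ge>N. norm (cl.nB (u n - x) - 0) < e" by blast
qed

lemma V_dense:
  assumes "x \<in> clV"
  shows "\<exists>g. (\<forall>n::nat. g n \<in> V) \<and> (\<lambda>n. cl.nB (g n - x)) \<longlonglongrightarrow> 0"
  using assms approx_cl_tendsto approx_in unfolding clV_def by blast

text \<open>Each member of a Cauchy sequence in \<open>clV\<close> is replaced by a member of
  \<open>V\<close> within 1/(n+1). The new sequence is form Cauchy in \<open>V\<close>, and its
  limit in the space belongs to \<open>clV\<close> by construction.\<close>

sublocale cl: closed_posform clV clB
proof
  fix u assume u: "\<And>n. u n \<in> clV" and c: "cl.cauchy u"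
  have "\<exists>d\<in>V. cl.nB (d - u n) < 1 / real (Suc n)" for n
  proof -
    obtain g where g: "\<And>k::nat. g k \<in> V" "(\<lambda>k. cl.nB (g k - u n)) \<longlonglongrightarrow> 0"
      using V_dense[OF u] by blast
    then have "\<exists>k. cl.nB (g k - u n) < 1 / real (Suc n)"
      using order_tendstoD(2)[OF g(2), of "1 / real (Suc n)"] eventually_happens[of _ sequentially]
      by fastforce
    then show ?thesis using g(1) by blast
  qed
  then obtain d where d: "\<And>n. d n \<in> V" "\<And>n. cl.nB (d n - u n) < 1 / real (Suc n)" by metis
  have dc: "d n \<in> clV" for n using d(1) V_subset_clV by blast
  have nB_eq: "cl.nB x = nB x" if "x \<in> V" for x
    using that by (simp add: cl.nB_def nB_def clB_eq_B)
  have lim: "(\<lambda>n. cl.nB (d n - u n)) \<longlonglongrightarrow> 0"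
  proof (rule tendsto_sandwich[OF _ _ tendsto_const LIMSEQ_Suc[OF lim_1_over_n]])
    show "\<forall>\<^sub>F n in sequentially. cl.nB (d n - u n) \<le> 1 / real (Suc n)"
      using d(2) less_imp_le by (intro always_eventually) blast
    show "\<forall>\<^sub>F n in sequentially. 0 \<le> cl.nB (d n - u n)"
      using dc u by (intro always_eventually) simp
  qed
  have "cauchy d" unfolding cauchy_nB[OF d(1)]
  proof (intro allI impI)
    fix e :: real assume e: "e > 0"
    have "\<forall>\<^sub>F n in sequentially. cl.nB (d n - u n) < e / 3"
      using order_tendstoD(2)[OF lim, of "e/3"] e by simp
    then obtain M where M: "\<And>n. n \<ge> M \<Longrightarrow> cl.nB (d n - u n) < e / 3"
      unfolding eventually_sequentially by blast
    obtain N where N: "\<And>n m. n \<ge> N \<Longrightarrow> m \<ge> N \<Longrightarrow> cl.nB (u n - u m) < e / 3"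
      using c e unfolding cl.cauchy_nB[OF u] by (meson divide_pos_pos zero_less_numeral)
    have "nB (d n - d m) < e" if "n \<ge> max N M" "m \<ge> max N M" for n m
    proof -
      have "cl.nB (d n - d m) \<le> cl.nB (d n - u n) + cl.nB (u n - d m)"
        by (rule cl.nB_triangle_diff[OF dc u dc])
      also have "cl.nB (u n - d m) \<le> cl.nB (u n - u m) + cl.nB (u m - d m)"
        by (rule cl.nB_triangle_diff[OF u u dc])
      also have "cl.nB (u m - d m) = cl.nB (d m - u m)" by (rule cl.nB_minus_commute[OF u dc])
      finally have "cl.nB (d n - d m) < e" using M[of n] M[of m] N[of n m] that by auto
      then show ?thesis using nB_eq d(1) by auto
    qed
    then show "\<exists>N. \<forall>n\<ge>N. \<forall>m\<ge>N. nB (d n - d m) < e" by blast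
  qed
  moreover obtain x where "d \<longlonglongrightarrow> x"
    using cauchy_imp_Cauchy[OF d(1) \<open>cauchy d\<close>] Cauchy_convergent convergentD by blast
  ultimately have a: "approx d x" using d(1) by (simp add: approx_def)
  then have x: "x \<in> clV" by (auto simp: clV_def)
  have bd: "norm (cl.nB (u n - x)) \<le> cl.nB (d n - u n) + cl.nB (d n - x)" for n
    using cl.nB_triangle_diff[OF u dc x, of n n] cl.nB_minus_commute[OF u dc, of n n]
      cl.nB_nonneg[of "u n - x"] u x by auto
  have "(\<lambda>n. cl.nB (u n - x)) \<longlonglongrightarrow> 0"
    by (rule Lim_null_comparison[OF always_eventually
          tendsto_add_zero[OF lim approx_cl_tendsto[OF a]]]) (use bd in blast)
  with x show "\<exists>x\<in>clV. (\<lambda>n. cl.nB (u n - x)) \<longlonglongrightarrow> 0" by blast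
qed

end

section \<open>The essential numerical range of a positive selfadjoint operator\<close>

definition wnull :: "(nat \<Rightarrow> 'a::real_inner) \<Rightarrow> bool" where
  "wnull x \<longleftrightarrow> (\<forall>y. (\<lambda>n. inner (x n) y) \<longlonglongrightarrow> 0)"

definition We_real :: "('a::real_inner \<Rightarrow> real) \<Rightarrow> 'a set \<Rightarrow> real set" where
  "We_real q E = {l. \<exists>x. (\<forall>n. x n \<in> E \<and> norm (x n) = 1) \<and> wnull x \<and> (\<lambda>n. q (x n)) \<longlonglongrightarrow> l}"

lemma wnull_add: "wnull x \<Longrightarrow> wnull y \<Longrightarrow> wnull (\<lambda>n. x n + y n)"
  unfolding wnull_def inner_add_left by (auto intro: tendsto_add_zero)

lemma wnull_scale: "c \<longlonglongrightarrow> l \<Longrightarrow> wnull x \<Longrightarrow> wnull (\<lambda>n. c n *\<^sub>R x n)"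
  unfolding wnull_def inner_scaleR_left by (metis mult_zero_right tendsto_mult)

lemma wnull_scale_const: "wnull x \<Longrightarrow> wnull (\<lambda>n. c *\<^sub>R x n)"
  using wnull_scale[OF tendsto_const] .

lemma wnull_diff: "wnull x \<Longrightarrow> wnull y \<Longrightarrow> wnull (\<lambda>n. x n - y n)"
  using wnull_add[OF _ wnull_scale_const[of y "-1"]] by simp

text \<open>Index choices with \<open>m n\<close> at least n tend to infinity without being
  monotone, hence a reindexing more general than a subsequence.\<close>

lemma wnull_compose: "wnull x \<Longrightarrow> filterlim r sequentially sequentially \<Longrightarrow> wnull (\<lambda>n. x (r n))"
  unfolding wnull_def using filterlim_compose[of _ _ sequentially r] by blast

lemma wnull_subseq: "wnull x \<Longrightarrow> strict_mono r \<Longrightarrow> wnull (\<lambda>n. x (r n))"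
  by (rule wnull_compose[OF _ filterlim_subseq])

lemma tendsto_zero_imp_wnull:
  assumes "x \<longlonglongrightarrow> 0"
  shows "wnull x"
  unfolding wnull_def
proof
  fix y
  show "(\<lambda>n. inner (x n) y) \<longlonglongrightarrow> 0"
    using tendsto_inner[OF assms tendsto_const, of y] by simp
qed

lemma filterlim_ge_self: "(\<And>n. n \<le> r n) \<Longrightarrow> filterlim r sequentially sequentially"
  for r :: "nat \<Rightarrow> nat"
  by (rule filterlim_at_top_mono[OF filterlim_ident]) auto

lemma norm_tendsto_of_diff:
  fixes x y :: "nat \<Rightarrow> 'a::real_normed_vector"
  assumes "(\<lambda>n. norm (x n - y n)) \<longlonglongrightarrow> 0" "(\<lambda>n. norm (y n)) \<longlonglongrightarrow> l"
  shows "(\<lambda>n. norm (x n)) \<longlonglongrightarrow> l"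
proof -
  have "norm (norm (x n) - norm (y n)) \<le> norm (x n - y n)" for n
    by (simp add: norm_triangle_ineq3)
  then have "(\<lambda>n. norm (x n) - norm (y n)) \<longlonglongrightarrow> 0"
    by (intro Lim_null_comparison[OF _ assms(1)] always_eventually) blast
  from tendsto_add[OF this assms(2)] show ?thesis by simp
qed

text \<open>The constructed singular sequences have unit norm only in the limit. Dividing by the
  norms rescales the form values by the inverse square, by homogeneity of degree two.\<close>

lemma We_real_normalize:
  assumes E: "subspace E" and q: "\<And>c x. x \<in> E \<Longrightarrow> q (c *\<^sub>R x) = c\<^sup>2 * q x"
    and z: "\<And>n. z n \<in> E" "wnull z"
    and n: "(\<lambda>n. norm (z n)) \<longlonglongrightarrow> \<rho>" "\<rho> > 0" and l: "(\<lambda>n. q (z n)) \<longlonglongrightarrow> \<beta>"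
  shows "\<beta> / \<rho>\<^sup>2 \<in> We_real q E"
proof -
  obtain N where N: "\<And>k. k \<ge> N \<Longrightarrow> norm (z k) > 0"
    using order_tendstoD(1)[OF n(1,2)] unfolding eventually_sequentially by blast
  \<comment> \<open>The shift by \<open>N\<close> skips the initial vectors that may vanish.\<close>
  define c where "c k = 1 / norm (z (k + N))" for k
  define x where "x k = c k *\<^sub>R z (k + N)" for k
  have sh: "filterlim (\<lambda>k. k + N) sequentially sequentially" by (rule filterlim_ge_self) simp
  have c: "c \<longlonglongrightarrow> 1 / \<rho>" unfolding c_def
    using n(2) by (intro tendsto_divide tendsto_const filterlim_compose[OF n(1) sh]) auto
  have "x k \<in> E \<and> norm (x k) = 1" for k
    using N[of "k + N"] z(1) E by (simp add: x_def c_def subspace_scale)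
  moreover have "wnull x" unfolding x_def by (intro wnull_scale[OF c] wnull_compose[OF z(2) sh])
  moreover have "(\<lambda>k. q (x k)) \<longlonglongrightarrow> (1 / \<rho>)\<^sup>2 * \<beta>"
    unfolding x_def q[OF z(1)]
    by (intro tendsto_mult tendsto_power c filterlim_compose[OF l sh])
  ultimately show ?thesis unfolding We_real_def by (auto simp: power_divide)
qed

text \<open>A diagonal choice: the n-th vector is almost orthogonal to the first n + 1 members of a
  dense sequence and has form value close to \<open>l\<close>. For unit vectors, testing against a
  dense set already gives weak convergence, which is where separability is used.\<close>

lemma We_real_closed:
  fixes q :: "'a::real_inner \<Rightarrow> real"
  assumes sep: "\<exists>C::'a set. countable C \<and> closure C = UNIV"
  shows "closed (We_real q E)"
proof (rule closed_sequential_limits[THEN iffD2], intro allI impI, elim conjE)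
  fix ls l assume ls: "\<forall>n. ls n \<in> We_real q E" "ls \<longlonglongrightarrow> l"
  obtain C :: "'a set" where C: "countable C" "closure C = UNIV" using sep by blast
  then have "C \<noteq> {}" by auto
  define c where "c = from_nat_into C"
  have rc: "range c = C" unfolding c_def using C(1) \<open>C \<noteq> {}\<close> by simp
  have "\<exists>x\<in>E. norm x = 1 \<and> (\<forall>j\<le>n. \<bar>inner x (c j)\<bar> < 1 / real (Suc n)) \<and> \<bar>q x - l\<bar> < 1 / real (Suc n)"
    for n
  proof -
    let ?e = "1 / real (Suc n)"
    obtain m where m: "\<bar>ls m - l\<bar> < ?e / 2"
      using LIMSEQ_D[OF ls(2), of "?e/2"] by auto
    obtain x where x: "\<And>k. x k \<in> E \<and> norm (x k) = 1" "wnull x" "(\<lambda>k. q (x k)) \<longlonglongrightarrow> ls m"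
      using ls(1) unfolding We_real_def by blast
    have "\<forall>\<^sub>F k in sequentially. \<bar>inner (x k) (c j)\<bar> < ?e" for j
      using x(2) tendstoD[of "\<lambda>k. inner (x k) (c j)" 0 sequentially ?e]
      unfolding wnull_def by (simp add: dist_real_def)
    then have "\<forall>\<^sub>F k in sequentially. \<forall>j\<in>{..n}. \<bar>inner (x k) (c j)\<bar> < ?e"
      by (intro eventually_ball_finite) auto
    moreover have "\<forall>\<^sub>F k in sequentially. \<bar>q (x k) - ls m\<bar> < ?e / 2"
      using tendstoD[OF x(3), of "?e/2"] by (simp add: dist_real_def)
    ultimately have "\<forall>\<^sub>F k in sequentially.
        (\<forall>j\<in>{..n}. \<bar>inner (x k) (c j)\<bar> < ?e) \<and> \<bar>q (x k) - ls m\<bar> < ?e / 2"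
      by (rule eventually_conj)
    then obtain k where "(\<forall>j\<in>{..n}. \<bar>inner (x k) (c j)\<bar> < ?e) \<and> \<bar>q (x k) - ls m\<bar> < ?e / 2"
      using eventually_happens[of _ sequentially] by force
    note k = this
    have "\<bar>q (x k) - l\<bar> \<le> \<bar>q (x k) - ls m\<bar> + \<bar>ls m - l\<bar>" by simp
    also have "\<dots> < ?e / 2 + ?e / 2" using k m by (intro add_strict_mono) auto
    also have "\<dots> = ?e" by (rule field_sum_of_halves)
    finally show ?thesis using x(1)[of k] k by (intro bexI[of _ "x k"]) auto
  qed
  then obtain x where x: "\<And>n. x n \<in> E" "\<And>n. norm (x n) = 1"
    "\<And>n j. j \<le> n \<Longrightarrow> \<bar>inner (x n) (c j)\<bar> < 1 / real (Suc n)"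
    "\<And>n. \<bar>q (x n) - l\<bar> < 1 / real (Suc n)"
    by metis
  note lim0 = LIMSEQ_Suc[OF lim_1_over_n]
  have "(\<lambda>n. q (x n) - l) \<longlonglongrightarrow> 0"
    by (rule Lim_null_comparison[OF always_eventually lim0]) (use x(4) less_imp_le in auto)
  then have lq: "(\<lambda>n. q (x n)) \<longlonglongrightarrow> l" by (simp add: LIM_zero_iff)
  have "wnull x" unfolding wnull_def
  proof (intro allI LIMSEQ_I)
    fix y and e :: real assume e: "e > 0"
    have "y \<in> closure C" using C(2) by simp
    then obtain j where j: "dist (c j) y < e / 2"
      using e rc unfolding closure_approachable by (metis half_gt_zero imageE)
    have "\<forall>\<^sub>F n in sequentially. 1 / real (Suc n) < e / 2"
      using order_tendstoD(2)[OF lim0, of "e/2"] e by simp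
    then obtain M where M: "\<And>n. n \<ge> M \<Longrightarrow> 1 / real (Suc n) < e / 2"
      unfolding eventually_sequentially by blast
    have "norm (inner (x n) y - 0) < e" if "n \<ge> max M j" for n
    proof -
      have "\<bar>inner (x n) (y - c j)\<bar> \<le> norm (y - c j)"
        using Cauchy_Schwarz_ineq2[of "x n" "y - c j"] x(2) by simp
      also have "\<dots> < e / 2" using j by (simp add: dist_norm norm_minus_commute)
      finally have "\<bar>inner (x n) y - inner (x n) (c j)\<bar> < e / 2" by (simp add: inner_diff_right)
      moreover have "\<bar>inner (x n) (c j)\<bar> < e / 2" using x(3)[of j n] M[of n] that by simp
      ultimately show ?thesis unfolding real_norm_def by linarith
    qed
    then show "\<exists>N. \<forall>n\<ge>N. norm (inner (x n) y - 0) < e" by blast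
  qed
  with x(1,2) lq show "l \<in> We_real q E" unfolding We_real_def by blast
qed

text \<open>An error tending to zero in the form norm also tends to zero in norm, so weak
  convergence and the limit of the norms survive. The form norm is Lipschitz for itself, so the
  values are compared through their square roots.\<close>

lemma (in posform) We_real_dense:
  assumes E: "subspace E" "E \<subseteq> V"
    and dense: "\<And>x. x \<in> V \<Longrightarrow> \<exists>g. (\<forall>n::nat. g n \<in> E) \<and> (\<lambda>n. nB (g n - x)) \<longlonglongrightarrow> 0"
  shows "We_real (\<lambda>x. B x x) V = We_real (\<lambda>x. B x x) E"
proof
  show "We_real (\<lambda>x. B x x) E \<subseteq> We_real (\<lambda>x. B x x) V"
    unfolding We_real_def using E(2) by blast
  show "We_real (\<lambda>x. B x x) V \<subseteq> We_real (\<lambda>x. B x x) E"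
  proof
    fix l assume "l \<in> We_real (\<lambda>x. B x x) V"
    then obtain x where x: "\<And>k. x k \<in> V" "\<And>k. norm (x k) = 1" "wnull x"
        "(\<lambda>k. B (x k) (x k)) \<longlonglongrightarrow> l"
      unfolding We_real_def by blast
    have "\<exists>g\<in>E. nB (g - x n) < 1 / real (Suc n)" for n
    proof -
      obtain g where g: "\<And>k::nat. g k \<in> E" "(\<lambda>k. nB (g k - x n)) \<longlonglongrightarrow> 0"
        using dense[OF x(1)] by blast
      then have "\<exists>k. nB (g k - x n) < 1 / real (Suc n)"
        using order_tendstoD(2)[OF g(2), of "1 / real (Suc n)"] eventually_happens[of _ sequentially]
        by fastforce
      then show ?thesis using g(1) by blast
    qed
    then obtain g where g: "\<And>n. g n \<in> E" "\<And>n. nB (g n - x n) < 1 / real (Suc n)" by metis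
    have gV: "g n \<in> V" for n using g(1) E(2) by blast
    note lim0 = LIMSEQ_Suc[OF lim_1_over_n]
    have lim: "(\<lambda>n. nB (g n - x n)) \<longlonglongrightarrow> 0"
    proof (rule Lim_null_comparison[OF always_eventually lim0], rule allI)
      fix n show "norm (nB (g n - x n)) \<le> 1 / real (Suc n)"
        using g(2)[of n] nB_nonneg[of "g n - x n"] gV x(1) by auto
    qed
    have limn: "(\<lambda>n. norm (g n - x n)) \<longlonglongrightarrow> 0"
    proof (rule Lim_null_comparison[OF always_eventually lim], rule allI)
      fix n show "norm (norm (g n - x n)) \<le> nB (g n - x n)"
        using norm_le_nB[of "g n - x n"] gV x(1) by auto
    qed
    have "(\<lambda>n. norm (g n)) \<longlonglongrightarrow> 1"
      by (rule norm_tendsto_of_diff[OF limn]) (simp add: x(2))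
    moreover have "wnull (\<lambda>n. (g n - x n) + x n)"
      by (rule wnull_add[OF tendsto_zero_imp_wnull[OF tendsto_norm_zero_cancel[OF limn]] x(3)])
    moreover have "(\<lambda>n. B (g n) (g n)) \<longlonglongrightarrow> l"
    proof -
      have "(\<lambda>n. (nB (x n))\<^sup>2) \<longlonglongrightarrow> l" using x(1,4) by (simp add: nB_square)
      then have "(\<lambda>n. sqrt ((nB (x n))\<^sup>2)) \<longlonglongrightarrow> sqrt l" by (rule tendsto_real_sqrt)
      then have s: "(\<lambda>n. nB (x n)) \<longlonglongrightarrow> sqrt l" using x(1) by simp
      have "norm (nB (g n) - nB (x n)) \<le> nB (g n - x n)" for n
        using nB_triangle[of "g n - x n" "x n"] nB_triangle[of "x n - g n" "g n"]
          nB_minus_commute[of "g n" "x n"] gV[of n] x(1)[of n] by simp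
      then have "(\<lambda>n. nB (g n) - nB (x n)) \<longlonglongrightarrow> 0"
        by (intro Lim_null_comparison[OF _ lim] always_eventually) blast
      from tendsto_power[OF tendsto_add[OF this s], of 2]
      have "(\<lambda>n. (nB (g n))\<^sup>2) \<longlonglongrightarrow> (sqrt l)\<^sup>2" by simp
      moreover have "0 \<le> l"
        by (rule LIMSEQ_le_const[OF x(4)]) (use B_nonneg x(1) in blast)
      ultimately show ?thesis using gV by (simp add: nB_square)
    qed
    ultimately show "l \<in> We_real (\<lambda>x. B x x) E"
      using We_real_normalize[OF E(1), of "\<lambda>x. B x x" g 1 l] E(2) g(1)
      by (auto simp: B_bilinear subset_iff power2_eq_square)
  qed
qed

section \<open>Convexity and endpoints for a positive operator\<close>

text \<open>Symmetry, the lower bound one and surjectivity stand in for selfadjointness: together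
  they give an everywhere defined symmetric inverse of norm at most one.\<close>

locale pos_op =
  fixes E :: "'a::real_inner set" and A :: "'a \<Rightarrow> 'a"
  assumes subspace_E: "subspace E"
    and A_add: "\<lbrakk>x \<in> E; y \<in> E\<rbrakk> \<Longrightarrow> A (x + y) = A x + A y"
    and A_scale: "x \<in> E \<Longrightarrow> A (c *\<^sub>R x) = c *\<^sub>R A x"
    and A_sym: "\<lbrakk>x \<in> E; y \<in> E\<rbrakk> \<Longrightarrow> inner (A x) y = inner x (A y)"
    and A_ge: "x \<in> E \<Longrightarrow> (norm x)\<^sup>2 \<le> inner (A x) x"
    and A_surj: "\<exists>x\<in>E. A x = h"
begin

lemmas E_closed [simp, intro] =
  subspace_0[OF subspace_E] subspace_add[OF subspace_E] subspace_diff[OF subspace_E]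
  subspace_scale[OF subspace_E] subspace_neg[OF subspace_E]

lemma A_diff: "\<lbrakk>x \<in> E; y \<in> E\<rbrakk> \<Longrightarrow> A (x - y) = A x - A y"
  using A_add[of x "(-1) *\<^sub>R y"] A_scale[of y "-1"] by simp

definition Q :: "'a \<Rightarrow> real" where "Q x = inner (A x) x"

definition ess :: "real set" where
  "ess = {l. \<exists>x. (\<forall>n. x n \<in> E \<and> norm (x n) = 1) \<and> wnull x \<and> (\<lambda>n. norm (A (x n) - l *\<^sub>R x n)) \<longlonglongrightarrow> 0}"

lemma Q_scale: "x \<in> E \<Longrightarrow> Q (c *\<^sub>R x) = c\<^sup>2 * Q x"
  by (simp add: Q_def A_scale power2_eq_square)

lemma Q_add: "\<lbrakk>x \<in> E; y \<in> E\<rbrakk> \<Longrightarrow> Q (x + y) = Q x + 2 * inner (A x) y + Q y"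
  using A_sym[of y x] by (simp add: Q_def A_add inner_add_left inner_add_right inner_commute)

lemma Q_nonneg: "x \<in> E \<Longrightarrow> 0 \<le> Q x"
  using A_ge[of x] unfolding Q_def by (meson order_trans zero_le_power2)

lemma ess_subset_We: "ess \<subseteq> We_real Q E"
proof
  fix l assume "l \<in> ess"
  then obtain x where x: "\<And>n. x n \<in> E" "\<And>n. norm (x n) = 1" "wnull x"
      "(\<lambda>n. norm (A (x n) - l *\<^sub>R x n)) \<longlonglongrightarrow> 0"
    unfolding ess_def by blast
  have "norm (Q (x n) - l) \<le> norm (A (x n) - l *\<^sub>R x n)" for n
  proof -
    have "Q (x n) - l = inner (A (x n) - l *\<^sub>R x n) (x n)"
      using x(2)[of n] by (simp add: Q_def inner_diff_left flip: power2_norm_eq_inner)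
    then show ?thesis using Cauchy_Schwarz_ineq2[of "A (x n) - l *\<^sub>R x n" "x n"] x(2) by simp
  qed
  then have "(\<lambda>n. Q (x n) - l) \<longlonglongrightarrow> 0"
    by (intro Lim_null_comparison[OF _ x(4)] always_eventually) blast
  then have "(\<lambda>n. Q (x n)) \<longlonglongrightarrow> l" by (simp add: LIM_zero_iff)
  with x show "l \<in> We_real Q E" unfolding We_real_def by blast
qed

lemma We_ge_1:
  assumes "l \<in> We_real Q E"
  shows "1 \<le> l"
proof -
  obtain x where x: "\<And>n. x n \<in> E" "\<And>n. norm (x n) = 1" "(\<lambda>n. Q (x n)) \<longlonglongrightarrow> l"
    using assms unfolding We_real_def by blast
  have "1 \<le> Q (x n)" for n using A_ge[OF x(1)[of n]] x(2)[of n] by (simp add: Q_def)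
  then show ?thesis using LIMSEQ_le_const[OF x(3)] by blast
qed

text \<open>With \<open>x n\<close> fixed, weak convergence makes some late \<open>y m\<close>
  almost orthogonal to both \<open>x n\<close> and \<open>A (x n)\<close>. The first removes the
  cross term of the norm, the second that of the form.\<close>

lemma We_convex:
  assumes a: "a \<in> We_real Q E" and b: "b \<in> We_real Q E" and l: "a \<le> l" "l \<le> b"
  shows "l \<in> We_real Q E"
proof -
  obtain t where t: "0 \<le> t" "t \<le> 1" "l = (1 - t) * a + t * b"
    using l by (metis atLeastAtMost_iff in_segment(1) closed_segment_eq_real_ivl1 order_trans real_scaleR_def)
  obtain x where x: "\<And>n. x n \<in> E" "\<And>n. norm (x n) = 1" "wnull x" "(\<lambda>n. Q (x n)) \<longlonglongrightarrow> a"
    using a unfolding We_real_def by blast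
  obtain y where y: "\<And>n. y n \<in> E" "\<And>n. norm (y n) = 1" "wnull y" "(\<lambda>n. Q (y n)) \<longlonglongrightarrow> b"
    using b unfolding We_real_def by blast
  have "\<exists>m\<ge>n. \<bar>inner (y m) (x n)\<bar> < 1 / real (Suc n) \<and> \<bar>inner (y m) (A (x n))\<bar> < 1 / real (Suc n)" for n
  proof -
    have "\<forall>\<^sub>F m in sequentially. \<bar>inner (y m) v\<bar> < 1 / real (Suc n)" for v
      using y(3) tendstoD[of "\<lambda>m. inner (y m) v" 0 sequentially "1 / real (Suc n)"]
      unfolding wnull_def by (simp add: dist_real_def)
    from this[of "x n"] this[of "A (x n)"] eventually_ge_at_top[of n]
    have "\<forall>\<^sub>F m in sequentially. m \<ge> n \<and> \<bar>inner (y m) (x n)\<bar> < 1 / real (Suc n)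
        \<and> \<bar>inner (y m) (A (x n))\<bar> < 1 / real (Suc n)"
      by eventually_elim auto
    then show ?thesis using eventually_happens[of _ sequentially] by force
  qed
  then obtain m where m: "\<And>n. m n \<ge> n" "\<And>n. \<bar>inner (y (m n)) (x n)\<bar> < 1 / real (Suc n)"
    "\<And>n. \<bar>inner (y (m n)) (A (x n))\<bar> < 1 / real (Suc n)" by metis
  note lim0 = LIMSEQ_Suc[OF lim_1_over_n]
  have mm: "filterlim m sequentially sequentially" by (rule filterlim_ge_self[OF m(1)])
  have c1: "(\<lambda>n. inner (x n) (y (m n))) \<longlonglongrightarrow> 0"
    by (rule Lim_null_comparison[OF always_eventually lim0]) (use m(2) less_imp_le in \<open>auto simp: inner_commute\<close>)
  have c2: "(\<lambda>n. inner (A (x n)) (y (m n))) \<longlonglongrightarrow> 0"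
    by (rule Lim_null_comparison[OF always_eventually lim0]) (use m(3) less_imp_le in \<open>auto simp: inner_commute\<close>)
  \<comment> \<open>Norm and form are quadratic, so the coefficients are the roots of the
    barycentric weights.\<close>
  define p where "p = sqrt (1 - t)"
  define r where "r = sqrt t"
  have pr: "p\<^sup>2 = 1 - t" "r\<^sup>2 = t" using t by (auto simp: p_def r_def)
  define z where "z n = p *\<^sub>R x n + r *\<^sub>R y (m n)" for n
  have zE: "z n \<in> E" for n using x(1) y(1) by (simp add: z_def)
  have zw: "wnull z" unfolding z_def
    by (intro wnull_add wnull_scale_const x(3) wnull_compose[OF y(3) mm])
  have "(norm (z n))\<^sup>2 = 1 + 2 * p * r * inner (x n) (y (m n))" for n
  proof -
    have "(norm (z n))\<^sup>2 = p\<^sup>2 * (norm (x n))\<^sup>2 + 2 * p * r * inner (x n) (y (m n)) + r\<^sup>2 * (norm (y (m n)))\<^sup>2"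
      unfolding power2_norm_eq_inner z_def
      by (simp add: inner_add_left inner_add_right inner_commute power2_eq_square)
    then show ?thesis using x(2) y(2) pr by simp
  qed
  moreover have "(\<lambda>n. 1 + 2 * p * r * inner (x n) (y (m n))) \<longlonglongrightarrow> 1 + 2 * p * r * 0"
    by (intro tendsto_intros c1)
  ultimately have "(\<lambda>n. sqrt ((norm (z n))\<^sup>2)) \<longlonglongrightarrow> sqrt 1" by (intro tendsto_real_sqrt) simp
  then have zn: "(\<lambda>n. norm (z n)) \<longlonglongrightarrow> 1" by simp
  have "Q (z n) = p\<^sup>2 * Q (x n) + 2 * p * r * inner (A (x n)) (y (m n)) + r\<^sup>2 * Q (y (m n))" for n
    using x(1) y(1) by (simp add: z_def Q_add Q_scale A_scale)
  moreover have "(\<lambda>n. p\<^sup>2 * Q (x n) + 2 * p * r * inner (A (x n)) (y (m n)) + r\<^sup>2 * Q (y (m n)))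
      \<longlonglongrightarrow> p\<^sup>2 * a + 2 * p * r * 0 + r\<^sup>2 * b"
    by (intro tendsto_intros c2 x(4) filterlim_compose[OF y(4) mm])
  ultimately have "(\<lambda>n. Q (z n)) \<longlonglongrightarrow> l" using pr t(3) by simp
  from We_real_normalize[OF subspace_E Q_scale zE zw zn _ this] show ?thesis by simp
qed

text \<open>Adding to a singular sequence for \<open>a\<close> a small multiple of unit vectors with exploding
  form values raises the limit of the form by any prescribed amount.\<close>

lemma We_unbounded:
  assumes a: "a \<in> We_real Q E" and unb: "\<And>M. \<exists>y\<in>E. Q y > M * (norm y)\<^sup>2" and l: "a \<le> l"
  shows "l \<in> We_real Q E"
proof -
  obtain x where x: "\<And>n. x n \<in> E" "\<And>n. norm (x n) = 1" "wnull x" "(\<lambda>n. Q (x n)) \<longlonglongrightarrow> a"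
    using a unfolding We_real_def by blast
  have "\<exists>y\<in>E. norm y = 1 \<and> Q y > real (Suc n)" for n
  proof -
    obtain y where y: "y \<in> E" "Q y > real (Suc n) * (norm y)\<^sup>2" using unb by blast
    have "y \<noteq> 0" using y(2) by (auto simp: Q_def)
    then have "Q ((1 / norm y) *\<^sub>R y) > real (Suc n)"
      using y by (simp add: Q_scale field_simps)
    moreover have "norm ((1 / norm y) *\<^sub>R y) = 1" using \<open>y \<noteq> 0\<close> by simp
    ultimately show ?thesis using y(1) by blast
  qed
  then obtain y where y: "\<And>n. y n \<in> E" "\<And>n. norm (y n) = 1" "\<And>n. Q (y n) > real (Suc n)"
    by metis
  \<comment> \<open>The \<open>y n\<close> need not be weakly null, so they are fixed first and
    \<open>x m\<close> is chosen against \<open>A (y n)\<close>; symmetry of \<open>A\<close> turns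
    this into the cross term of the form.\<close>
  have "\<exists>m\<ge>n. \<bar>inner (x m) (A (y n))\<bar> < 1 / real (Suc n)" for n
  proof -
    have "\<forall>\<^sub>F m in sequentially. \<bar>inner (x m) (A (y n))\<bar> < 1 / real (Suc n)"
      using x(3) tendstoD[of "\<lambda>m. inner (x m) (A (y n))" 0 sequentially "1 / real (Suc n)"]
      unfolding wnull_def by (simp add: dist_real_def)
    with eventually_ge_at_top[of n]
    have "\<forall>\<^sub>F m in sequentially. m \<ge> n \<and> \<bar>inner (x m) (A (y n))\<bar> < 1 / real (Suc n)"
      by eventually_elim auto
    then show ?thesis using eventually_happens[of _ sequentially] by force
  qed
  then obtain m where m: "\<And>n. m n \<ge> n" "\<And>n. \<bar>inner (x (m n)) (A (y n))\<bar> < 1 / real (Suc n)"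
    by metis
  note lim0 = LIMSEQ_Suc[OF lim_1_over_n]
  have mm: "filterlim m sequentially sequentially" by (rule filterlim_ge_self[OF m(1)])
  have c: "(\<lambda>n. inner (A (x (m n))) (y n)) \<longlonglongrightarrow> 0"
  proof (rule Lim_null_comparison[OF always_eventually lim0], rule allI)
    fix n show "norm (inner (A (x (m n))) (y n)) \<le> 1 / real (Suc n)"
      using m(2)[of n] A_sym[OF x(1) y(1)] by simp
  qed
  \<comment> \<open>The weight makes the added form value exactly \<open>l - a\<close>; since
    \<open>Q (y n)\<close> exceeds n + 1, it tends to zero and the added vectors vanish in
    norm.\<close>
  define e where "e n = sqrt ((l - a) / Q (y n))" for n
  have Qpos: "Q (y n) > 0" for n using y(3)[of n] by linarith
  have e2: "(e n)\<^sup>2 * Q (y n) = l - a" for n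
    using Qpos[of n] l by (simp add: e_def)
  have e0: "e \<longlonglongrightarrow> 0"
  proof -
    have "(\<lambda>n. (l - a) / Q (y n)) \<longlonglongrightarrow> 0"
    proof (rule Lim_null_comparison[OF always_eventually])
      show "(\<lambda>n. (l - a) * (1 / real (Suc n))) \<longlonglongrightarrow> 0" by (rule tendsto_mult_right_zero[OF lim0])
      show "\<forall>n. norm ((l - a) / Q (y n)) \<le> (l - a) * (1 / real (Suc n))"
      proof
        fix n
        have "(l - a) / Q (y n) \<le> (l - a) / real (Suc n)"
          using y(3)[of n] l by (intro divide_left_mono) auto
        then show "norm ((l - a) / Q (y n)) \<le> (l - a) * (1 / real (Suc n))"
          using l Qpos[of n] by simp
      qed
    qed
    from tendsto_real_sqrt[OF this] show ?thesis unfolding e_def[abs_def] by simp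
  qed
  define z where "z n = x (m n) + e n *\<^sub>R y n" for n
  have zE: "z n \<in> E" for n using x(1) y(1) by (simp add: z_def)
  have ey: "(\<lambda>n. norm (e n *\<^sub>R y n)) \<longlonglongrightarrow> 0" using tendsto_rabs_zero[OF e0] y(2) by simp
  have zw: "wnull z" unfolding z_def
    by (rule wnull_add[OF wnull_compose[OF x(3) mm]
          tendsto_zero_imp_wnull[OF tendsto_norm_zero_cancel[OF ey]]])
  have zn: "(\<lambda>n. norm (z n)) \<longlonglongrightarrow> 1"
    by (rule norm_tendsto_of_diff[of z "\<lambda>n. x (m n)"]) (use ey x(2) in \<open>simp_all add: z_def\<close>)
  have "Q (z n) = Q (x (m n)) + 2 * e n * inner (A (x (m n))) (y n) + (l - a)" for n
    using x(1) y(1) e2[of n] by (simp add: z_def Q_add Q_scale)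
  moreover have "(\<lambda>n. Q (x (m n)) + 2 * e n * inner (A (x (m n))) (y n) + (l - a))
      \<longlonglongrightarrow> a + 2 * 0 * 0 + (l - a)"
    by (intro tendsto_intros c e0 filterlim_compose[OF x(4) mm])
  ultimately have "(\<lambda>n. Q (z n)) \<longlonglongrightarrow> l" by simp
  from We_real_normalize[OF subspace_E Q_scale zE zw zn _ this] show ?thesis by simp
qed

text \<open>The sign \<sigma> is 1 at a lower and -1 at an upper endpoint. If the bound failed
  infinitely often, norms and form values would converge along a subsequence, and normalizing would
  produce a value beyond \<open>L\<close>, unless the norms tend to zero.\<close>

lemma eventually_form_bound:
  assumes \<sigma>: "\<sigma> = 1 \<or> (\<sigma> = -1 \<and> (\<forall>x\<in>E. Q x \<le> M * (norm x)\<^sup>2))"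
    and ext: "\<And>l. l \<in> We_real Q E \<Longrightarrow> 0 \<le> \<sigma> * (l - L)"
    and z: "\<And>n. z n \<in> E" "wnull z" "\<And>n. Q (z n) \<le> K" and e: "e > 0"
  shows "\<forall>\<^sub>F n in sequentially. - e < \<sigma> * (Q (z n) - L * (norm (z n))\<^sup>2)"
proof (rule ccontr)
  assume "\<not> ?thesis"
  from not_eventually_sequentiallyD[OF this] obtain r :: "nat \<Rightarrow> nat" where r: "strict_mono r"
    "\<And>n. \<sigma> * (Q (z (r n)) - L * (norm (z (r n)))\<^sup>2) \<le> - e"
    unfolding linorder_not_less by blast
  \<comment> \<open>Pairing the two bounded quantities yields one subsequence along which both
    converge.\<close>
  define f where "f n = (norm (z (r n)), Q (z (r n)))" for n
  have "bounded (range f)"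
  proof (rule bounded_subset[OF bounded_cbox[of "(0, 0)" "(sqrt K, K)"]])
    have "norm (z k) \<le> sqrt K" for k
      using A_ge[OF z(1)[of k]] z(3)[of k] by (intro real_le_rsqrt) (simp add: Q_def)
    then show "range f \<subseteq> cbox (0, 0) (sqrt K, K)"
      using z(1,3) Q_nonneg by (auto simp: f_def cbox_Pair_eq)
  qed
  then obtain p s where s: "strict_mono (s :: nat \<Rightarrow> nat)" "(f \<circ> s) \<longlonglongrightarrow> p"
    using bounded_imp_convergent_subsequence[of f] by blast
  define w where "w n = z (r (s n))" for n
  obtain \<rho> \<beta> where p: "p = (\<rho>, \<beta>)" by (cases p)
  have w1: "(\<lambda>n. norm (w n)) \<longlonglongrightarrow> \<rho>" using tendsto_fst[OF s(2)] by (simp add: p f_def w_def o_def)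
  have w2: "(\<lambda>n. Q (w n)) \<longlonglongrightarrow> \<beta>" using tendsto_snd[OF s(2)] by (simp add: p f_def w_def o_def)
  have wE: "w n \<in> E" for n using z(1) by (simp add: w_def)
  have ww: "wnull w" unfolding w_def by (intro wnull_subseq[OF wnull_subseq[OF z(2) r(1)] s(1)])
  have "(\<lambda>n. \<sigma> * (Q (w n) - L * (norm (w n))\<^sup>2)) \<longlonglongrightarrow> \<sigma> * (\<beta> - L * \<rho>\<^sup>2)"
    by (intro tendsto_intros w1 w2)
  then have neg: "\<sigma> * (\<beta> - L * \<rho>\<^sup>2) \<le> - e"
    by (rule LIMSEQ_le_const2) (use r(2) in \<open>auto simp: w_def\<close>)
  have rho0: "0 \<le> \<rho>" by (rule LIMSEQ_le_const[OF w1]) auto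
  show False
  proof (cases "\<rho> = 0")
    case False
    then have "\<beta> / \<rho>\<^sup>2 \<in> We_real Q E"
      using We_real_normalize[OF subspace_E Q_scale wE ww w1 _ w2] rho0 by simp
    then have "0 \<le> \<sigma> * (\<beta> / \<rho>\<^sup>2 - L)" by (rule ext)
    then have "0 \<le> \<rho>\<^sup>2 * (\<sigma> * (\<beta> / \<rho>\<^sup>2 - L))" by simp
    also have "\<dots> = \<sigma> * (\<beta> - L * \<rho>\<^sup>2)" using False by (simp add: field_simps)
    finally show False using neg e by simp
  next
    case True
    \<comment> \<open>Vanishing limit norm: nonnegativity of \<open>Q\<close> excludes \<sigma> = 1,
      and for \<sigma> = -1 the bound \<open>M\<close> forces the form values to zero as
      well.\<close>
    have "0 \<le> \<beta>" by (rule LIMSEQ_le_const[OF w2]) (use Q_nonneg wE in blast)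
    then have "\<sigma> = -1" and b: "\<forall>x\<in>E. Q x \<le> M * (norm x)\<^sup>2" and "\<beta> > 0"
      using \<sigma> neg e True by auto
    have "(\<lambda>n. M * (norm (w n))\<^sup>2) \<longlonglongrightarrow> M * \<rho>\<^sup>2" by (intro tendsto_intros w1)
    then have "\<beta> \<le> M * \<rho>\<^sup>2" by (rule LIMSEQ_le[OF w2]) (use b wE in blast)
    then show False using \<open>\<beta> > 0\<close> True by simp
  qed
qed

text \<open>For a singular sequence \<open>x\<close> of an extremal value \<open>L\<close>, the defect \<open>y = x - L A\<^sup>-\<^sup>1 x\<close> is the
  gradient of the shifted form at \<open>x\<close>. A step in its direction cannot beat \<open>L\<close> asymptotically, which
  forces \<open>y\<close> to tend to zero, so that \<open>A\<^sup>-\<^sup>1 x\<close> is a singular sequence for the operator.\<close>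

lemma extremal_in_ess:
  assumes \<sigma>: "\<sigma> = 1 \<or> (\<sigma> = -1 \<and> (\<forall>x\<in>E. Q x \<le> M * (norm x)\<^sup>2))"
    and L: "L \<in> We_real Q E"
    and ext: "\<And>l. l \<in> We_real Q E \<Longrightarrow> 0 \<le> \<sigma> * (l - L)"
  shows "L \<in> ess"
proof -
  obtain x where x: "\<And>n. x n \<in> E" "\<And>n. norm (x n) = 1" "wnull x" "(\<lambda>n. Q (x n)) \<longlonglongrightarrow> L"
    using L unfolding We_real_def by blast
  have L1: "1 \<le> L" using We_ge_1[OF L] .
  have \<sigma>2: "\<sigma> * \<sigma> = 1" using \<sigma> by auto
  have "\<forall>n. \<exists>w\<in>E. A w = x n" using A_surj by blast
  then obtain w where w: "\<And>n. w n \<in> E" "\<And>n. A (w n) = x n" by metis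
  define y where "y n = x n - L *\<^sub>R w n" for n
  have yE: "y n \<in> E" for n using x(1) w(1) by (simp add: y_def)
  \<comment> \<open>Every test vector is \<open>A g\<close> for some \<open>g\<close>, so symmetry
    moves the inverse from \<open>x n\<close> to the test vector.\<close>
  have ww: "wnull w" unfolding wnull_def
  proof
    fix v
    obtain g where g: "g \<in> E" "A g = v" using A_surj by blast
    have "inner (w n) v = inner (x n) g" for n using A_sym[OF w(1) g(1)] w(2) g(2) by simp
    then show "(\<lambda>n. inner (w n) v) \<longlonglongrightarrow> 0" using x(3) by (simp add: wnull_def)
  qed
  have yw: "wnull y" unfolding y_def by (intro wnull_diff wnull_scale_const x(3) ww)
  \<comment> \<open>Since \<open>A (y n) = A (x n) - L *\<^sub>R x n\<close>, the derivative of the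
    shifted form at \<open>x n\<close> in the direction \<open>y n\<close> is twice
    \<open>Q (y n)\<close>.\<close>
  have cross: "inner (A (x n) - L *\<^sub>R x n) (y n) = Q (y n)" for n
    using x(1) w(1) by (simp add: Q_def y_def A_diff A_scale w(2))
  have wn: "norm (w n) \<le> 1" for n
  proof -
    have "(norm (w n))\<^sup>2 \<le> inner (x n) (w n)" using A_ge[OF w(1)[of n]] w(2) by simp
    also have "\<dots> \<le> norm (w n)" using Cauchy_Schwarz_ineq2[of "x n" "w n"] x(2) by simp
    finally show ?thesis by (cases "w n = 0") (simp_all add: power2_eq_square)
  qed
  have "Bseq (\<lambda>n. Q (x n))" using x(4) convergentI convergent_imp_Bseq by blast
  then obtain K0 where K0: "\<And>n. norm (Q (x n)) \<le> K0" unfolding Bseq_def by blast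
  have Qw: "Q (w n) \<le> 1" for n
    using Cauchy_Schwarz_ineq2[of "x n" "w n"] x(2)[of n] wn[of n] by (simp add: Q_def w(2))
  have Q_sum: "Q (u + v) \<le> 2 * Q u + 2 * Q v" if "u \<in> E" "v \<in> E" for u v
    using Q_nonneg[of "u + (-1) *\<^sub>R v"] Q_add[of u "(-1) *\<^sub>R v"] Q_add[OF that] Q_scale[of v "-1"] that
    by simp
  have Qy: "Q (y n) \<le> 2 * K0 + 2 * L\<^sup>2" for n
  proof -
    have "Q (y n) \<le> 2 * Q (x n) + 2 * Q ((-L) *\<^sub>R w n)"
      using Q_sum[OF x(1)[of n], of "(-L) *\<^sub>R w n"] w(1)[of n] E_closed(4) by (simp add: y_def)
    also have "\<dots> = 2 * Q (x n) + 2 * (L\<^sup>2 * Q (w n))" using Q_scale[OF w(1)[of n], of "-L"] by simp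
    also have "\<dots> \<le> 2 * K0 + 2 * (L\<^sup>2 * 1)"
      using K0[of n] Qw[of n] by (intro add_mono mult_left_mono) auto
    finally show ?thesis by simp
  qed
  define q where "q v = Q v - L * (norm v)\<^sup>2" for v
  define K where "K = 1 + L"
  have K: "K > 0" using L1 by (simp add: K_def)
  have q_le: "\<bar>q v\<bar> \<le> K * Q v" if "v \<in> E" for v
  proof -
    have "(norm v)\<^sup>2 \<le> Q v" using A_ge[OF that] by (simp add: Q_def)
    then have "L * (norm v)\<^sup>2 \<le> L * Q v" using L1 by (intro mult_left_mono) auto
    moreover have "0 \<le> L * (norm v)\<^sup>2" using L1 by simp
    moreover have "0 \<le> L * Q v" using L1 Q_nonneg[OF that] by simp
    ultimately show ?thesis using Q_nonneg[OF that] by (simp add: q_def K_def algebra_simps abs_le_iff)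
  qed
  \<comment> \<open>By \<open>q_le\<close> the change of \<sigma> q is at most (2 s + K s^2) Q(y n)
    with s = \<sigma> \<tau>. This is least at s = -1/K, where it equals - Q(y n) / K.\<close>
  define \<tau> where "\<tau> = - \<sigma> / K"
  define z where "z n = x n + \<tau> *\<^sub>R y n" for n
  have zE: "z n \<in> E" for n using x(1) yE by (simp add: z_def)
  have zw: "wnull z" unfolding z_def by (intro wnull_add wnull_scale_const x(3) yw)
  have zQ: "Q (z n) \<le> 2 * K0 + 2 * (\<tau>\<^sup>2 * (2 * K0 + 2 * L\<^sup>2))" for n
  proof -
    have "Q (z n) \<le> 2 * Q (x n) + 2 * (\<tau>\<^sup>2 * Q (y n))"
      using Q_sum[OF x(1)[of n], of "\<tau> *\<^sub>R y n"] yE Q_scale by (simp add: z_def)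
    also have "\<dots> \<le> 2 * K0 + 2 * (\<tau>\<^sup>2 * (2 * K0 + 2 * L\<^sup>2))"
      using K0[of n] Qy[of n] by (intro add_mono mult_left_mono) auto
    finally show ?thesis .
  qed
  have qz: "\<sigma> * q (z n) \<le> \<sigma> * q (x n) - Q (y n) / K" for n
  proof -
    have nz: "(norm (z n))\<^sup>2 = (norm (x n))\<^sup>2 + 2 * \<tau> * inner (x n) (y n) + \<tau>\<^sup>2 * (norm (y n))\<^sup>2"
      unfolding power2_norm_eq_inner z_def
      by (simp add: inner_add_left inner_add_right inner_commute power2_eq_square)
    have Qz: "Q (z n) = Q (x n) + 2 * \<tau> * inner (A (x n)) (y n) + \<tau>\<^sup>2 * Q (y n)"
      using x(1) yE by (simp add: z_def Q_add Q_scale)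
    have "q (z n) = q (x n) + 2 * \<tau> * Q (y n) + \<tau>\<^sup>2 * q (y n)"
      using cross[of n] unfolding q_def nz Qz by (simp add: inner_diff_left algebra_simps)
    then have "\<sigma> * q (z n) = \<sigma> * q (x n) + 2 * (\<sigma> * \<tau>) * Q (y n) + \<sigma> * (\<tau>\<^sup>2 * q (y n))"
      by (simp add: algebra_simps)
    also have "\<sigma> * \<tau> = - 1 / K" using \<sigma>2 by (simp add: \<tau>_def)
    also have "\<tau>\<^sup>2 = 1 / K\<^sup>2" using \<sigma>2 by (simp add: \<tau>_def power2_eq_square)
    also have "\<sigma> * (1 / K\<^sup>2 * q (y n)) \<le> 1 / K\<^sup>2 * (K * Q (y n))"
    proof -
      have "\<sigma> * q (y n) \<le> K * Q (y n)" using \<sigma> q_le[OF yE[of n]] by auto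
      then have "1 / K\<^sup>2 * (\<sigma> * q (y n)) \<le> 1 / K\<^sup>2 * (K * Q (y n))"
        by (intro mult_left_mono) auto
      then show ?thesis by (simp add: mult.left_commute)
    qed
    finally show ?thesis using K by (simp add: power2_eq_square field_simps)
  qed
  have qx: "(\<lambda>n. \<sigma> * q (x n)) \<longlonglongrightarrow> 0"
  proof -
    have "(\<lambda>n. \<sigma> * (Q (x n) - L)) \<longlonglongrightarrow> \<sigma> * (L - L)" by (intro tendsto_intros x(4))
    then show ?thesis by (simp add: q_def x(2))
  qed
  have Qy0: "(\<lambda>n. Q (y n)) \<longlonglongrightarrow> 0"
  proof (rule LIMSEQ_I)
    fix e :: real assume e: "e > 0"
    \<comment> \<open>Both errors, at \<open>x n\<close> and at \<open>z n\<close>, are below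
      \<open>?d\<close>, so \<open>Q (y n) / K\<close> is below \<open>e / K\<close>.\<close>
    let ?d = "e / (2 * K)"
    have d: "?d > 0" using e K by simp
    have "\<forall>\<^sub>F n in sequentially. - ?d < \<sigma> * q (z n)"
      unfolding q_def by (rule eventually_form_bound[OF \<sigma> ext zE zw zQ d])
    moreover have "\<forall>\<^sub>F n in sequentially. \<sigma> * q (x n) < ?d"
      by (rule order_tendstoD(2)[OF qx d])
    ultimately have "\<forall>\<^sub>F n in sequentially. norm (Q (y n) - 0) < e"
    proof eventually_elim
      case (elim n)
      then have "Q (y n) / K < e / K" using qz[of n] K by (simp add: field_simps)
      then have "Q (y n) < e" using K by (simp add: divide_less_cancel)
      then show ?case using Q_nonneg[OF yE] by simp
    qed
    then show "\<exists>N. \<forall>n\<ge>N. norm (Q (y n) - 0) < e" unfolding eventually_sequentially by blast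
  qed
  have y0: "(\<lambda>n. norm (y n)) \<longlonglongrightarrow> 0"
  proof -
    have lim: "(\<lambda>n. sqrt (Q (y n))) \<longlonglongrightarrow> 0" using tendsto_real_sqrt[OF Qy0] by simp
    have "norm (norm (y n)) \<le> sqrt (Q (y n))" for n
      using A_ge[OF yE] by (simp add: Q_def real_le_rsqrt)
    then show ?thesis by (intro Lim_null_comparison[OF _ lim] always_eventually) blast
  qed
  \<comment> \<open>The difference of \<open>L *\<^sub>R w n\<close> and the unit vector
    \<open>x n\<close> is \<open>y n\<close> up to sign, so the norms of \<open>w n\<close> tend to
    1/L and normalization is possible.\<close>
  have Lw: "(\<lambda>n. norm (L *\<^sub>R w n)) \<longlonglongrightarrow> 1"
  proof (rule norm_tendsto_of_diff[of _ x])
    show "(\<lambda>n. norm (L *\<^sub>R w n - x n)) \<longlonglongrightarrow> 0"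
      using y0 unfolding y_def by (simp add: norm_minus_commute)
  qed (simp add: x(2))
  have "(\<lambda>n. norm (L *\<^sub>R w n) / L) \<longlonglongrightarrow> 1 / L" by (intro tendsto_intros Lw) (use L1 in auto)
  then have wnl: "(\<lambda>n. norm (w n)) \<longlonglongrightarrow> 1 / L" using L1 by simp
  obtain N where N: "\<And>n. n \<ge> N \<Longrightarrow> norm (w n) > 0"
    using order_tendstoD(1)[OF wnl, of 0] L1 unfolding eventually_sequentially by auto
  define v where "v n = (1 / norm (w (n + N))) *\<^sub>R w (n + N)" for n
  have sh: "filterlim (\<lambda>k. k + N) sequentially sequentially" by (rule filterlim_ge_self) simp
  have il: "(\<lambda>n. 1 / norm (w (n + N))) \<longlonglongrightarrow> 1 / (1 / L)"
    by (intro tendsto_divide tendsto_const filterlim_compose[OF wnl sh]) (use L1 in auto)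
  have "v n \<in> E \<and> norm (v n) = 1" for n
    using N[of "n + N"] w(1) by (simp add: v_def)
  moreover have "wnull v" unfolding v_def by (intro wnull_scale[OF il] wnull_compose[OF ww sh])
  moreover have "(\<lambda>n. norm (A (v n) - L *\<^sub>R v n)) \<longlonglongrightarrow> 0"
  proof -
    have "A (v n) - L *\<^sub>R v n = (1 / norm (w (n + N))) *\<^sub>R y (n + N)" for n
      using w(1) by (simp add: v_def A_scale w(2) y_def algebra_simps)
    moreover have "(\<lambda>n. (1 / norm (w (n + N))) * norm (y (n + N))) \<longlonglongrightarrow> 1 / (1 / L) * 0"
      by (intro tendsto_mult il filterlim_compose[OF y0 sh])
    ultimately show ?thesis by simp
  qed
  ultimately show ?thesis unfolding ess_def by blast
qed

text \<open>The range is closed and bounded below by one, so its infimum is attained and lies in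
  \<open>ess\<close>; so does its supremum when the form is bounded above. The right-hand side is a
  convex hull in which unboundedness acts as the endpoint infinity.\<close>

theorem We_eq_conv_ess:
  assumes sep: "\<exists>C::'a set. countable C \<and> closure C = UNIV"
  shows "l \<in> We_real Q E \<longleftrightarrow>
    (\<exists>a\<in>ess. a \<le> l \<and> ((\<forall>M. \<exists>x\<in>E. Q x > M * (norm x)\<^sup>2) \<or> (\<exists>b\<in>ess. l \<le> b)))"
proof
  assume "\<exists>a\<in>ess. a \<le> l \<and> ((\<forall>M. \<exists>x\<in>E. Q x > M * (norm x)\<^sup>2) \<or> (\<exists>b\<in>ess. l \<le> b))"
  then show "l \<in> We_real Q E" using We_convex We_unbounded ess_subset_We by (meson subsetD)
next
  assume l: "l \<in> We_real Q E"
  note cl = We_real_closed[OF sep, of Q E]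
  have ne: "We_real Q E \<noteq> {}" using l by blast
  have bb: "bdd_below (We_real Q E)" using We_ge_1 by (rule bdd_belowI)
  have "Inf (We_real Q E) \<in> We_real Q E" by (rule closed_contains_Inf[OF ne bb cl])
  then have a: "Inf (We_real Q E) \<in> ess"
    using extremal_in_ess[of 1 0] cInf_lower[OF _ bb] by simp
  have al: "Inf (We_real Q E) \<le> l" by (rule cInf_lower[OF l bb])
  show "\<exists>a\<in>ess. a \<le> l \<and> ((\<forall>M. \<exists>x\<in>E. Q x > M * (norm x)\<^sup>2) \<or> (\<exists>b\<in>ess. l \<le> b))"
  proof (cases "\<forall>M. \<exists>x\<in>E. Q x > M * (norm x)\<^sup>2")
    case True
    then show ?thesis using a al by blast
  next
    case False
    then obtain M where M: "\<forall>x\<in>E. Q x \<le> M * (norm x)\<^sup>2" by (meson linorder_not_less)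
    have "s \<le> M" if s: "s \<in> We_real Q E" for s
    proof -
      obtain x where x: "\<And>n. x n \<in> E" "\<And>n. norm (x n) = 1" "(\<lambda>n. Q (x n)) \<longlonglongrightarrow> s"
        using s unfolding We_real_def by blast
      have "Q (x n) \<le> M" for n using M x(1,2)[of n] by fastforce
      then show ?thesis using LIMSEQ_le_const2[OF x(3)] by blast
    qed
    then have ba: "bdd_above (We_real Q E)" by (rule bdd_aboveI)
    have "Sup (We_real Q E) \<in> We_real Q E" by (rule closed_contains_Sup[OF ne ba cl])
    then have "Sup (We_real Q E) \<in> ess"
      using extremal_in_ess[of "-1" M] cSup_upper[OF _ ba] M by simp
    then show ?thesis using a al cSup_upper[OF l ba] by blast
  qed
qed

end

section \<open>Sectorial operators\<close>

lemma cinner_add_right: "cinner x (y + z) = cinner x y + cinner x (z::'a::complex_inner)"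
  by (metis cinner_add_left cinner_commute complex_cnj_add)

lemma cinner_scaleC_right: "cinner x (scaleC a y) = cnj a * cinner x (y::'a::complex_inner)"
  by (metis cinner_scaleC_left cinner_commute complex_cnj_mult)

text \<open>The second slot is conjugate linear, so i contributes the factor -i there. This reduces
  complex identities to pairs of real ones.\<close>

lemma Im_cinner: "Im (cinner x y) = inner x (scaleC \<i> (y::'a::complex_inner))"
  using Re_cinner[of x "scaleC \<i> y"] by (simp add: cinner_scaleC_right)

lemma Im_cinner_self [simp]: "Im (cinner x (x::'a::complex_inner)) = 0"
proof -
  have "Im (cinner x x) = - Im (cinner x x)" by (metis cinner_commute cnj.simps(2))
  then show ?thesis by simp
qed

lemma cinner_self: "cinner x x = complex_of_real ((norm (x::'a::complex_inner))\<^sup>2)"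
  by (simp add: complex_eq_iff Re_cinner power2_norm_eq_inner)

lemma cinner_diff_left: "cinner (x - y) z = cinner x z - cinner (y::'a::complex_inner) z"
  using cinner_add_left[of "x - y" y z] by simp

lemma inner_i_i: "inner (scaleC \<i> x) (scaleC \<i> y) = inner x (y::'a::complex_inner)"
  using Re_cinner[of "scaleC \<i> x" "scaleC \<i> y"]
  by (simp add: cinner_scaleC_left cinner_scaleC_right Re_cinner)

lemma inner_i_left: "inner (scaleC \<i> x) y = - inner x (scaleC \<i> (y::'a::complex_inner))"
  using Re_cinner[of "scaleC \<i> x" y] by (simp add: cinner_scaleC_left Im_cinner)

lemma norm_scaleC: "norm (scaleC a x) = cmod a * norm (x::'a::complex_inner)"
proof -
  have "complex_of_real ((norm (scaleC a x))\<^sup>2) = a * (cnj a * complex_of_real ((norm x)\<^sup>2))"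
    unfolding cinner_self[symmetric] cinner_scaleC_left cinner_scaleC_right
    by (rule mult.left_commute)
  also have "\<dots> = complex_of_real ((cmod a * norm x)\<^sup>2)"
    using complex_norm_square[of a] by (simp add: power_mult_distrib)
  finally have "complex_of_real ((norm (scaleC a x))\<^sup>2) = complex_of_real ((cmod a * norm x)\<^sup>2)" .
  then show ?thesis by (simp only: of_real_eq_iff) (simp add: power2_eq_iff_nonneg)
qed

lemma scaleC_minus_one: "scaleC (-1) x = - (x::'a::complex_inner)"
  using scaleC_of_real[of "-1" x] by simp

lemma scaleC_one: "scaleC 1 x = (x::'a::complex_inner)"
  using scaleC_of_real[of "1" x] by simp

lemma scaleC_diff_right: "scaleC a (x - y) = scaleC a x - scaleC a (y::'a::complex_inner)"
  using scaleC_add_right[of a "x - y" y] by simp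

lemma norm_cinner_le: "cmod (cinner x y) \<le> norm x * norm (y::'a::complex_inner)"
proof (cases "cinner x y = 0")
  case False
  \<comment> \<open>A unimodular factor that rotates the inner product onto the positive axis, where
    the real Cauchy-Schwarz inequality applies.\<close>
  define a where "a = cnj (cinner x y) / complex_of_real (cmod (cinner x y))"
  have "a * cinner x y = complex_of_real (cmod (cinner x y))"
    using False complex_norm_square[of "cinner x y"]
    by (simp add: a_def field_simps power2_eq_square)
  then have "cmod (cinner x y) = inner (scaleC a x) y"
    using Re_cinner[of "scaleC a x" y] by (simp add: cinner_scaleC_left)
  also have "\<dots> \<le> norm (scaleC a x) * norm y" by (rule norm_cauchy_schwarz)
  also have "norm (scaleC a x) = norm x"
    using False by (simp add: norm_scaleC a_def norm_divide)
  finally show ?thesis .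
qed simp

text \<open>Testing the real inner product against i y controls the imaginary part at y.\<close>

lemma weakly_to_zero_iff_wnull: "weakly_to_zero x \<longleftrightarrow> wnull x"
proof
  assume *: "weakly_to_zero x"
  show "wnull x" unfolding wnull_def
  proof
    fix y
    have "(\<lambda>n. Re (cinner (x n) y)) \<longlonglongrightarrow> Re 0"
      using * unfolding weakly_to_zero_def by (intro tendsto_Re) blast
    then show "(\<lambda>n. inner (x n) y) \<longlonglongrightarrow> 0" by (simp add: Re_cinner)
  qed
next
  assume *: "wnull x"
  then show "weakly_to_zero x"
    unfolding weakly_to_zero_def wnull_def by (simp add: tendsto_complex_iff Re_cinner Im_cinner)
qed

lemma csubspace_imp_subspace:
  assumes "csubspace (D :: 'a::complex_inner set)"
  shows "subspace D"
  using assms unfolding csubspace_def by (metis scaleC_of_real subspace_def)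

text \<open>The representation lemma for the form \<open>inner\<close> itself; it serves to show
  that a bounded resolvent preserves weakly null sequences.\<close>

lemma riesz_bounded_linear:
  fixes f :: "'a::{real_inner,complete_space} \<Rightarrow> real"
  assumes "bounded_linear f"
  shows "\<exists>p. \<forall>v. f v = inner p v"
proof -
  interpret H: posform "UNIV :: 'a set" inner
    by standard (auto simp: inner_add_left power2_norm_eq_inner intro: inner_commute)
  have nB: "H.nB x = norm x" for x by (simp add: H.nB_def norm_eq_sqrt_inner)
  interpret H: closed_posform "UNIV :: 'a set" inner
  proof
    fix u assume "H.cauchy u"
    then have "Cauchy u" by (intro H.cauchy_imp_Cauchy) auto
    then obtain x where x: "u \<longlonglongrightarrow> x" using Cauchy_convergent convergentD by blast
    show "\<exists>x\<in>UNIV. (\<lambda>n. H.nB (u n - x)) \<longlonglongrightarrow> 0"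
      unfolding nB using tendsto_norm_zero[OF LIM_zero[OF x]] by blast
  qed
  interpret f: bounded_linear f by fact
  obtain C where C: "\<And>x. norm (f x) \<le> norm x * C" using f.bounded by blast
  have "\<exists>p\<in>UNIV. \<forall>v\<in>UNIV. inner p v = f v"
    by (rule H.riesz[of f C]) (use C in \<open>auto simp: f.add f.scale nB mult.commute\<close>)
  then show ?thesis by (metis UNIV_I)
qed

section \<open>Bounds and closability for sectorial forms\<close>

text \<open>\<open>c\<close> moves the real part of the form above the squared norm, and
  \<open>M\<close> plays the part of the tangent of the semi-angle for the shifted sector.\<close>

locale sectorial_op =
  fixes T :: "'a::complex_inner \<Rightarrow> 'a" and D :: "'a set" and c M :: real
  assumes lin: "lin_op T D"
    and lower: "x \<in> D \<Longrightarrow> (norm x)\<^sup>2 \<le> inner (T x) x + c * (norm x)\<^sup>2"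
    and Im_bound: "x \<in> D \<Longrightarrow> \<bar>Im (cinner (T x) x)\<bar> \<le> M * (inner (T x) x + c * (norm x)\<^sup>2)"
    and M_nonneg: "0 \<le> M"
begin

lemma csub: "csubspace D"
  using lin by (simp add: lin_op_def)

lemma D_scaleC [simp, intro]: "x \<in> D \<Longrightarrow> scaleC a x \<in> D"
  using csub by (simp add: csubspace_def)

lemma T_add: "x \<in> D \<Longrightarrow> y \<in> D \<Longrightarrow> T (x + y) = T x + T y"
  using lin by (simp add: lin_op_def)

lemma T_scaleC: "x \<in> D \<Longrightarrow> T (scaleC a x) = scaleC a (T x)"
  using lin by (simp add: lin_op_def)

lemma T_scaleR: "x \<in> D \<Longrightarrow> T (r *\<^sub>R x) = r *\<^sub>R T x"
  by (metis T_scaleC scaleC_of_real)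

text \<open>The real part of the sesquilinear form \<open>Re_form (op_form T)\<close>, shifted by
  \<open>c\<close>.\<close>

definition b :: "'a \<Rightarrow> 'a \<Rightarrow> real" where
  "b x y = (inner (T x) y + inner x (T y)) / 2 + c * inner x y"

lemma b_self: "b x x = inner (T x) x + c * (norm x)\<^sup>2"
  by (simp add: b_def inner_commute power2_norm_eq_inner)

sublocale posform D b
proof
  show "subspace D" by (rule csubspace_imp_subspace[OF csub])
next
  fix x y z assume "x \<in> D" "y \<in> D" "z \<in> D"
  then show "b (x + y) z = b x z + b y z"
    by (simp add: b_def T_add inner_add_left field_simps)
next
  fix x y r assume "x \<in> D" "y \<in> D"
  then show "b (r *\<^sub>R x) y = r * b x y"
    by (simp add: b_def T_scaleR field_simps)
next
  fix x y show "b x y = b y x"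
    by (simp add: b_def inner_commute add.commute)
next
  fix x assume "x \<in> D"
  then show "(norm x)\<^sup>2 \<le> b x x" unfolding b_self by (rule lower)
qed

lemma b_i_i: "x \<in> D \<Longrightarrow> y \<in> D \<Longrightarrow> b (scaleC \<i> x) (scaleC \<i> y) = b x y"
  by (simp add: b_def T_scaleC inner_i_i)

lemma quadratic_bound:
  assumes "x \<in> D"
  shows "cmod (cinner (T x) x) \<le> (1 + \<bar>c\<bar> + M) * b x x"
proof -
  have n: "(norm x)\<^sup>2 \<le> b x x" using lower[OF assms] by (simp add: b_self)
  have "\<bar>inner (T x) x\<bar> \<le> b x x + \<bar>c\<bar> * (norm x)\<^sup>2"
  proof -
    have "inner (T x) x = b x x - c * (norm x)\<^sup>2" by (simp add: b_self)
    also have "\<bar>\<dots>\<bar> \<le> \<bar>b x x\<bar> + \<bar>c * (norm x)\<^sup>2\<bar>" by (rule abs_triangle_ineq4)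
    finally show ?thesis using B_nonneg[OF assms] by (simp add: abs_mult)
  qed
  also have "\<dots> \<le> b x x + \<bar>c\<bar> * b x x" using n by (intro add_left_mono mult_left_mono) auto
  finally have "\<bar>Re (cinner (T x) x)\<bar> + \<bar>Im (cinner (T x) x)\<bar> \<le> (b x x + \<bar>c\<bar> * b x x) + M * b x x"
    using Im_bound[OF assms] by (simp add: Re_cinner b_self)
  with cmod_le[of "cinner (T x) x"] show ?thesis by (simp add: algebra_simps)
qed

text \<open>Polarization and the parallelogram law turn \<open>quadratic_bound\<close> into a bound
  by \<open>b x x + b y y\<close>; scaling both vectors to form norm one gives the product and the
  factor 2.\<close>

lemma sesquilinear_bound:
  assumes x: "x \<in> D" and y: "y \<in> D"
  shows "cmod (cinner (T x) y) \<le> 2 * (1 + \<bar>c\<bar> + M) * (nB x * nB y)"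
proof -
  let ?K = "1 + \<bar>c\<bar> + M"
  have sum: "cmod (cinner (T x) y) \<le> ?K * (b x x + b y y)" if x: "x \<in> D" and y: "y \<in> D" for x y
  proof -
    define q where "q a = cinner (T (x + scaleC a y)) (x + scaleC a y)" for a
    have expand: "q a = cinner (T x) x + cnj a * cinner (T x) y + a * cinner (T y) x
        + a * cnj a * cinner (T y) y" for a
      using x y by (simp add: q_def T_add T_scaleC cinner_add_left cinner_add_right
          cinner_scaleC_left cinner_scaleC_right algebra_simps)
    \<comment> \<open>Complex polarization, which is needed because the form is not
      symmetric.\<close>
    have "4 * cinner (T x) y = q 1 - q (-1) + \<i> * q \<i> - \<i> * q (- \<i>)"
      unfolding expand by (simp add: algebra_simps)
    then have "4 * cmod (cinner (T x) y) = cmod (q 1 - q (-1) + \<i> * q \<i> - \<i> * q (- \<i>))"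
      by (metis norm_mult norm_numeral)
    also have "\<dots> \<le> cmod (q 1) + cmod (q (-1)) + cmod (\<i> * q \<i>) + cmod (\<i> * q (- \<i>))"
      by (meson norm_triangle_le norm_triangle_le_diff norm_triangle_ineq4 order_refl add_mono)
    also have "\<dots> = cmod (q 1) + cmod (q (-1)) + cmod (q \<i>) + cmod (q (- \<i>))"
      by (simp add: norm_mult)
    also have "\<dots> \<le> ?K * b (x + y) (x + y) + ?K * b (x - y) (x - y)
        + ?K * b (x + scaleC \<i> y) (x + scaleC \<i> y) + ?K * b (x - scaleC \<i> y) (x - scaleC \<i> y)"
    proof -
      have qb: "cmod (q a) \<le> ?K * b (x + scaleC a y) (x + scaleC a y)" for a
        unfolding q_def using x y by (intro quadratic_bound) auto
      have "scaleC (- \<i>) y = - scaleC \<i> y"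
        by (metis scaleC_minus_one scaleC_scaleC mult_minus1)
      then show ?thesis
        using qb[of 1] qb[of "-1"] qb[of \<i>] qb[of "-\<i>"] by (simp add: scaleC_one scaleC_minus_one)
    qed
    also have "\<dots> = ?K * (4 * (b x x + b y y))"
    proof -
      have para: "b (x + z) (x + z) + b (x - z) (x - z) = 2 * (b x x + b z z)" if "z \<in> D" for z
        using x that by (simp add: B_bilinear)
      have "b (x + y) (x + y) + b (x - y) (x - y) + b (x + scaleC \<i> y) (x + scaleC \<i> y)
          + b (x - scaleC \<i> y) (x - scaleC \<i> y) = 4 * (b x x + b y y)"
        using para[OF y] para[of "scaleC \<i> y"] y b_i_i[OF y y] by simp
      then show ?thesis by (simp only: flip: distrib_left)
    qed
    also have "\<dots> = 4 * (?K * (b x x + b y y))" by (rule mult.left_commute)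
    finally show ?thesis by (simp only: mult_le_cancel_left_pos[OF zero_less_numeral])
  qed
  show ?thesis
  proof (cases "nB x = 0 \<or> nB y = 0")
    case True
    then have "x = 0 \<or> y = 0" using norm_le_nB[OF x] norm_le_nB[OF y] by auto
    moreover have "T 0 = 0" using T_scaleR[of 0 0] by simp
    ultimately have "cinner (T x) y = 0"
      using norm_cinner_le[of "T x" y] by auto
    then show ?thesis using x y M_nonneg by simp
  next
    case False
    then have pos: "nB x > 0" "nB y > 0" using x y nB_nonneg by (metis order_le_less)+
    let ?x = "(1 / nB x) *\<^sub>R x" and ?y = "(1 / nB y) *\<^sub>R y"
    have "nB ?x = 1" "nB ?y = 1" using x y pos by (simp_all add: nB_scale)
    then have "b ?x ?x = 1" "b ?y ?y = 1" using x y nB_square by (metis V_closed(4) one_power2)+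
    with sum[of ?x ?y] x y have "cmod (cinner (T ?x) ?y) \<le> ?K * 2" by simp
    moreover have "cinner (T ?x) ?y
        = complex_of_real (1 / nB x) * (complex_of_real (1 / nB y) * cinner (T x) y)"
      using x unfolding T_scaleR[OF x]
      by (simp only: scaleC_of_real[symmetric] cinner_scaleC_left cinner_scaleC_right
          complex_cnj_complex_of_real mult.left_commute)
    ultimately have "cmod (cinner (T x) y) / (nB x * nB y) \<le> ?K * 2"
      using pos by (simp add: norm_mult norm_divide)
    then show ?thesis using pos by (simp add: field_simps)
  qed
qed

text \<open>Closability comes from splitting t(u n, u n) into t(u n, u n - u m) + t(u n, u m). The
  form bound makes the first part small, and the second tends to zero in m because t(u n, .) is the
  inner product with a fixed vector. The form \<open>b\<close> offers no such continuity, as it also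
  contains \<open>T\<close> in the second argument.\<close>

sublocale closable_posform D b
proof
  fix u assume u: "\<And>n. u n \<in> D" "u \<longlonglongrightarrow> 0" "cauchy u"
  define K where "K = 2 * (1 + \<bar>c\<bar> + M)"
  have K: "K > 0" using M_nonneg by (simp add: K_def)
  obtain N0 where N0: "\<And>n m. n \<ge> N0 \<Longrightarrow> m \<ge> N0 \<Longrightarrow> nB (u n - u m) < 1"
    using u(3) unfolding cauchy_nB[OF u(1)] by (meson zero_less_one)
  define C where "C = nB (u N0) + 1"
  have C: "C > 0" using nB_nonneg[OF u(1)] by (simp add: C_def add_nonneg_pos)
  have bd: "nB (u n) \<le> C" if "n \<ge> N0" for n
    using N0[of n N0] nB_triangle[of "u n - u N0" "u N0"] u(1) that by (simp add: C_def)
  have "(\<lambda>n. cinner (T (u n)) (u n)) \<longlonglongrightarrow> 0"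
  proof (rule LIMSEQ_I)
    fix e :: real assume e: "e > 0"
    then have "e / (2 * K * C) > 0" using K C by simp
    then obtain N where N: "\<And>n m. n \<ge> N \<Longrightarrow> m \<ge> N \<Longrightarrow> nB (u n - u m) < e / (2 * K * C)"
      using u(3) unfolding cauchy_nB[OF u(1)] by meson
    have "cmod (cinner (T (u n)) (u n)) < e" if n: "n \<ge> max N N0" for n
    proof -
      have est: "cmod (cinner (T (u n)) (u n)) \<le> e / 2 + cmod (cinner (T (u n)) (u m))"
        if m: "m \<ge> N" for m
      proof -
        have "cinner (T (u n)) (u n) = cinner (T (u n)) (u n - u m) + cinner (T (u n)) (u m)"
          by (simp flip: cinner_add_right)
        then have "cmod (cinner (T (u n)) (u n))
            \<le> cmod (cinner (T (u n)) (u n - u m)) + cmod (cinner (T (u n)) (u m))"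
          by (metis norm_triangle_ineq)
        also have "cmod (cinner (T (u n)) (u n - u m)) \<le> K * (nB (u n) * nB (u n - u m))"
          unfolding K_def using u(1) by (intro sesquilinear_bound) auto
        also have "\<dots> \<le> K * (C * (e / (2 * K * C)))"
          using K bd[of n] N[of n m] n m u(1) nB_nonneg C
          by (intro mult_left_mono mult_mono) auto
        also have "\<dots> = e / 2" using K C by (simp add: field_simps)
        finally show ?thesis by simp
      qed
      have "(\<lambda>m. norm (T (u n)) * norm (u m)) \<longlonglongrightarrow> norm (T (u n)) * 0"
        by (intro tendsto_mult tendsto_const tendsto_norm_zero u(2))
      then have l: "(\<lambda>m. norm (T (u n)) * norm (u m)) \<longlonglongrightarrow> 0" by simp
      have "(\<lambda>m. cmod (cinner (T (u n)) (u m))) \<longlonglongrightarrow> 0"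
        by (rule Lim_null_comparison[OF always_eventually l]) (simp add: norm_cinner_le)
      then have "(\<lambda>m. e / 2 + cmod (cinner (T (u n)) (u m))) \<longlonglongrightarrow> e / 2 + 0"
        by (intro tendsto_add tendsto_const)
      then have "cmod (cinner (T (u n)) (u n)) \<le> e / 2 + 0"
        by (rule LIMSEQ_le_const) (use est in blast)
      then show ?thesis using e by simp
    qed
    then show "\<exists>N. \<forall>n\<ge>N. norm (cinner (T (u n)) (u n) - 0) < e" by (metis diff_zero)
  qed
  then have "(\<lambda>n. Re (cinner (T (u n)) (u n))) \<longlonglongrightarrow> Re 0" by (rule tendsto_Re)
  then have 1: "(\<lambda>n. inner (T (u n)) (u n)) \<longlonglongrightarrow> 0" by (simp add: Re_cinner)
  have "(\<lambda>n. inner (T (u n)) (u n) + c * (norm (u n))\<^sup>2) \<longlonglongrightarrow> 0 + c * 0\<^sup>2"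
    by (intro tendsto_intros 1 tendsto_norm_zero u(2))
  then show "(\<lambda>n. b (u n) (u n)) \<longlonglongrightarrow> 0" by (simp add: b_self)
qed

end

section \<open>The real part of a sectorial operator\<close>

context sectorial_op
begin

lemma Re_form_eq:
  assumes "x \<in> D" "y \<in> D"
  shows "Re_form (op_form T) x y = Complex (b x y - c * inner x y)
    (b x (scaleC \<i> y) - c * inner x (scaleC \<i> y))"
  using assms cinner_commute[of x "T y"]
  by (simp add: Re_form_def adj_form_def op_form_def complex_eq_iff Re_cinner Im_cinner b_def
      T_scaleC inner_i_left inner_commute)

lemma Re_form_self: "Re_form (op_form T) x x = complex_of_real (inner (T x) x)"
  by (simp add: Re_form_def adj_form_def op_form_def complex_eq_iff Re_cinner)

text \<open>The shift adds only \<open>c\<close> times the squared norm of \<open>u n - u m\<close>,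
  which is negligible because an approximating sequence converges in norm.\<close>

lemma form_approx_iff: "form_approx (Re_form (op_form T)) D u x \<longleftrightarrow> approx u x"
proof (cases "(\<forall>n. u n \<in> D) \<and> u \<longlonglongrightarrow> x")
  case True
  then have u: "u n \<in> D" for n by blast
  let ?t = "\<lambda>n m. inner (T (u n - u m)) (u n - u m)"
  let ?d = "\<lambda>n m. u n - u m"
  have t: "cmod (Re_form (op_form T) (?d n m) (?d n m)) = \<bar>?t n m\<bar>" for n m
    by (simp add: Re_form_self)
  have bt: "\<bar>b (?d n m) (?d n m) - ?t n m\<bar> \<le> \<bar>c\<bar> * (norm (?d n m))\<^sup>2" for n m
    by (simp add: b_self abs_mult)
  have small: "\<exists>N. \<forall>n\<ge>N. \<forall>m\<ge>N. \<bar>c\<bar> * (norm (?d n m))\<^sup>2 < e" if e: "e > 0" for e :: real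
  proof -
    let ?e = "sqrt (e / (\<bar>c\<bar> + 1))"
    have e': "?e > 0" using e by (simp add: add_nonneg_pos)
    have "Cauchy u" using True LIMSEQ_imp_Cauchy by blast
    then obtain N where N: "\<And>m n. m \<ge> N \<Longrightarrow> n \<ge> N \<Longrightarrow> norm (?d m n) < ?e"
      using e' unfolding Cauchy_iff by meson
    have "\<bar>c\<bar> * (norm (?d n m))\<^sup>2 < e" if "n \<ge> N" "m \<ge> N" for n m
    proof -
      have "(norm (?d n m))\<^sup>2 < ?e\<^sup>2" using N[OF that] by (intro power_strict_mono) auto
      also have "?e\<^sup>2 = e / (\<bar>c\<bar> + 1)" using e by simp
      finally have "(\<bar>c\<bar> + 1) * (norm (?d n m))\<^sup>2 < e" by (simp add: field_simps)
      then show ?thesis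
        using zero_le_power2[of "norm (?d n m)"] unfolding distrib_right mult_1 by linarith
    qed
    then show ?thesis by blast
  qed
  have "form_cauchy (Re_form (op_form T)) u \<longleftrightarrow> cauchy u"
  proof
    assume a: "form_cauchy (Re_form (op_form T)) u"
    show "cauchy u" unfolding cauchy_def
    proof (intro allI impI)
      fix e :: real assume "e > 0"
      then have e: "e / 2 > 0" by simp
      obtain N where N: "\<And>n m. n \<ge> N \<Longrightarrow> m \<ge> N \<Longrightarrow> \<bar>?t n m\<bar> < e / 2"
        using a e unfolding form_cauchy_def t by meson
      obtain N' where N': "\<And>n m. n \<ge> N' \<Longrightarrow> m \<ge> N' \<Longrightarrow> \<bar>c\<bar> * (norm (?d n m))\<^sup>2 < e / 2"
        using small[OF e] by blast
      have "b (?d n m) (?d n m) < e" if "n \<ge> max N N'" "m \<ge> max N N'" for n m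
        using N[of n m] N'[of n m] bt[of n m] that by auto
      then show "\<exists>N. \<forall>n\<ge>N. \<forall>m\<ge>N. b (?d n m) (?d n m) < e" by blast
    qed
  next
    assume a: "cauchy u"
    show "form_cauchy (Re_form (op_form T)) u" unfolding form_cauchy_def t
    proof (intro allI impI)
      fix e :: real assume "e > 0"
      then have e: "e / 2 > 0" by simp
      obtain N where N: "\<And>n m. n \<ge> N \<Longrightarrow> m \<ge> N \<Longrightarrow> b (?d n m) (?d n m) < e / 2"
        using a e unfolding cauchy_def by meson
      obtain N' where N': "\<And>n m. n \<ge> N' \<Longrightarrow> m \<ge> N' \<Longrightarrow> \<bar>c\<bar> * (norm (?d n m))\<^sup>2 < e / 2"
        using small[OF e] by blast
      have "\<bar>?t n m\<bar> < e" if "n \<ge> max N N'" "m \<ge> max N N'" for n m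
        using N[of n m] N'[of n m] bt[of n m] that B_nonneg[of "?d n m"] u by auto
      then show "\<exists>N. \<forall>n\<ge>N. \<forall>m\<ge>N. \<bar>?t n m\<bar> < e" by blast
    qed
  qed
  then show ?thesis by (simp add: form_approx_def approx_def)
qed (auto simp: form_approx_def approx_def)

abbreviation clF :: "'a \<Rightarrow> 'a \<Rightarrow> complex" where
  "clF \<equiv> closure_form (Re_form (op_form T)) D"

lemma closure_form_dom_eq: "closure_form_dom (Re_form (op_form T)) D = clV"
  by (simp add: closure_form_dom_def clV_def form_approx_iff)

lemma approx_i:
  assumes "approx u x"
  shows "approx (\<lambda>n. scaleC \<i> (u n)) (scaleC \<i> x)"
proof -
  have u: "u n \<in> D" for n using approx_in[OF assms] .
  have "cauchy (\<lambda>n. scaleC \<i> (u n))"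
    using assms u by (simp add: approx_def cauchy_def b_i_i flip: scaleC_diff_right)
  moreover have "(\<lambda>n. scaleC \<i> (u n)) \<longlonglongrightarrow> scaleC \<i> x"
  proof -
    have "(\<lambda>n. norm (u n - x)) \<longlonglongrightarrow> 0"
      using assms unfolding approx_def by (intro tendsto_norm_zero LIM_zero) blast
    then have "(\<lambda>n. norm (scaleC \<i> (u n) - scaleC \<i> x)) \<longlonglongrightarrow> 0"
      by (simp add: norm_scaleC flip: scaleC_diff_right)
    from LIM_zero_cancel[OF tendsto_norm_zero_cancel[OF this]] show ?thesis .
  qed
  ultimately show ?thesis using u by (simp add: approx_def)
qed

lemma clV_i: "x \<in> clV \<Longrightarrow> scaleC \<i> x \<in> clV"
  using approx_i by (auto simp: clV_def)

lemma Re_form_tendsto: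
  assumes "approx u x" "approx v y"
  shows "(\<lambda>n. Re_form (op_form T) (u n) (v n)) \<longlonglongrightarrow> Complex (clB x y - c * inner x y)
    (clB x (scaleC \<i> y) - c * inner x (scaleC \<i> y))"
proof -
  have uv: "u n \<in> D" "v n \<in> D" for n using approx_in assms by auto
  have main: "(\<lambda>n. b (u n) (w n) - c * inner (u n) (w n)) \<longlonglongrightarrow> clB x z - c * inner x z"
    if "approx w z" for w z
    by (intro tendsto_diff tendsto_mult tendsto_const tendsto_inner clB_tendsto[OF assms(1) that])
      (use assms(1) that in \<open>auto simp: approx_def\<close>)
  show ?thesis unfolding Re_form_eq[OF uv]
    by (intro tendsto_Complex main assms(2) approx_i)
qed

text \<open>The sequences chosen inside \<open>closure_form\<close> are approximating ones, so their
  limit is already known, whatever the choice.\<close>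

lemma clF_eq:
  assumes "x \<in> clV" "y \<in> clV"
  shows "clF x y = Complex (clB x y - c * inner x y)
    (clB x (scaleC \<i> y) - c * inner x (scaleC \<i> y))"
proof -
  obtain u v where "approx u x" "approx v y" using assms by (auto simp: clV_def)
  then have "approx (SOME u. approx u x) x" "approx (SOME v. approx v y) y"
    using someI[of "\<lambda>u. approx u x"] someI[of "\<lambda>v. approx v y"] by blast+
  from limI[OF Re_form_tendsto[OF this]] show ?thesis
    unfolding closure_form_def form_approx_iff .
qed

lemma clF_self:
  assumes "x \<in> clV"
  shows "clF x x = complex_of_real (clB x x - c * (norm x)\<^sup>2)"
proof -
  obtain u where u: "approx u x" using assms by (auto simp: clV_def)
  from tendsto_Im[OF Re_form_tendsto[OF u u]]
  have "(\<lambda>n. 0) \<longlonglongrightarrow> clB x (scaleC \<i> x) - c * inner x (scaleC \<i> x)"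
    by (simp add: Re_form_self)
  then have "clB x (scaleC \<i> x) - c * inner x (scaleC \<i> x) = 0"
    using LIMSEQ_unique tendsto_const by metis
  then show ?thesis using clF_eq[OF assms assms] by (simp add: complex_eq_iff power2_norm_eq_inner)
qed

text \<open>Stability of \<open>clV\<close> under i lets a real representing vector represent the
  complex form too: the identity at i y is the imaginary part of the one at y.\<close>

lemma clF_represented_iff:
  assumes x: "x \<in> clV"
  shows "(\<forall>y\<in>clV. clF x y = cinner z y) \<longleftrightarrow> (\<forall>y\<in>clV. clB x y = inner (z + c *\<^sub>R x) y)"
proof
  assume *: "\<forall>y\<in>clV. clF x y = cinner z y"
  show "\<forall>y\<in>clV. clB x y = inner (z + c *\<^sub>R x) y"
  proof
    fix y assume y: "y \<in> clV"
    then have "Re (clF x y) = Re (cinner z y)" using * by simp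
    then show "clB x y = inner (z + c *\<^sub>R x) y"
      using clF_eq[OF x y] by (simp add: Re_cinner inner_add_left)
  qed
next
  assume *: "\<forall>y\<in>clV. clB x y = inner (z + c *\<^sub>R x) y"
  show "\<forall>y\<in>clV. clF x y = cinner z y"
  proof
    fix y assume y: "y \<in> clV"
    then show "clF x y = cinner z y"
      using * clV_i[OF y]
      by (simp add: clF_eq[OF x y] complex_eq_iff Re_cinner Im_cinner inner_add_left)
  qed
qed

lemma ReT_dom_eq: "ReT_dom T D = cl.op_dom"
proof -
  have "(\<exists>z. \<forall>y\<in>clV. clF x y = cinner z y) \<longleftrightarrow> (\<exists>z. \<forall>y\<in>clV. clB x y = inner z y)"
    if "x \<in> clV" for x
    unfolding clF_represented_iff[OF that] by (metis diff_add_cancel)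
  then show ?thesis
    unfolding ReT_dom_def assoc_op_dom_def closure_form_dom_eq cl.op_dom_def by blast
qed

definition A :: "'a \<Rightarrow> 'a" where "A x = ReT T D x + c *\<^sub>R x"

lemma ReT_clF:
  assumes "x \<in> cl.op_dom" "y \<in> clV"
  shows "clF x y = cinner (ReT T D x) y"
proof -
  have "x \<in> assoc_op_dom clF clV"
    using assms(1) ReT_dom_eq unfolding ReT_dom_def closure_form_dom_eq by simp
  then have "\<exists>z. \<forall>y\<in>clV. clF x y = cinner z y" unfolding assoc_op_dom_def by blast
  from someI_ex[OF this] assms(2) show ?thesis
    unfolding ReT_def assoc_op_def closure_form_dom_eq by blast
qed

lemma A_clB:
  assumes "x \<in> cl.op_dom" "y \<in> clV"
  shows "clB x y = inner (A x) y"
proof -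
  have "x \<in> clV" using assms(1) cl.op_dom_subset by blast
  from clF_represented_iff[OF this] ReT_clF[OF assms(1)] assms(2) show ?thesis
    unfolding A_def by blast
qed

lemma ReT_self:
  assumes "x \<in> cl.op_dom"
  shows "cinner (ReT T D x) x = complex_of_real (inner (A x) x - c * (norm x)\<^sup>2)"
proof -
  have x: "x \<in> clV" using assms cl.op_dom_subset by blast
  show ?thesis using ReT_clF[OF assms x] clF_self[OF x] A_clB[OF assms x] by simp
qed

text \<open>The imaginary part of the form is dominated by its real part, so it converges along a
  subsequence.\<close>

lemma Re_We_op: "Re ` We_op T D = {r. r + c \<in> We_real (\<lambda>x. b x x) D}"
proof
  show "Re ` We_op T D \<subseteq> {r. r + c \<in> We_real (\<lambda>x. b x x) D}"
  proof
    fix r assume "r \<in> Re ` We_op T D"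
    then obtain l x where l: "r = Re l" and x: "\<And>n. x n \<in> D" "\<And>n. norm (x n) = 1" "wnull x"
        "(\<lambda>n. cinner (T (x n)) (x n)) \<longlonglongrightarrow> l"
      unfolding We_op_def We_form_def op_form_def weakly_to_zero_iff_wnull by blast
    have "(\<lambda>n. Re (cinner (T (x n)) (x n)) + c) \<longlonglongrightarrow> r + c"
      unfolding l by (intro tendsto_add tendsto_const tendsto_Re x(4))
    then have "(\<lambda>n. b (x n) (x n)) \<longlonglongrightarrow> r + c" by (simp add: b_self x(2) Re_cinner)
    with x show "r \<in> {r. r + c \<in> We_real (\<lambda>x. b x x) D}" unfolding We_real_def by blast
  qed
  show "{r. r + c \<in> We_real (\<lambda>x. b x x) D} \<subseteq> Re ` We_op T D"
  proof
    fix r assume "r \<in> {r. r + c \<in> We_real (\<lambda>x. b x x) D}"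
    then obtain x where x: "\<And>n. x n \<in> D" "\<And>n. norm (x n) = 1" "wnull x"
        "(\<lambda>n. b (x n) (x n)) \<longlonglongrightarrow> r + c"
      unfolding We_real_def by blast
    let ?K = "1 + \<bar>c\<bar> + M"
    have "Bseq (\<lambda>n. b (x n) (x n))" using x(4) convergentI convergent_imp_Bseq by blast
    then obtain C where C: "\<And>n. norm (b (x n) (x n)) \<le> C" unfolding Bseq_def by blast
    have "cmod (cinner (T (x n)) (x n)) \<le> ?K * C" for n
    proof -
      have "cmod (cinner (T (x n)) (x n)) \<le> ?K * b (x n) (x n)" by (rule quadratic_bound[OF x(1)])
      also have "\<dots> \<le> ?K * C" using C[of n] M_nonneg by (intro mult_left_mono) auto
      finally show ?thesis .
    qed
    then have "bounded (range (\<lambda>n. cinner (T (x n)) (x n)))" unfolding bounded_iff by blast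
    then obtain l s where s: "strict_mono (s :: nat \<Rightarrow> nat)"
        "((\<lambda>n. cinner (T (x n)) (x n)) \<circ> s) \<longlonglongrightarrow> l"
      using bounded_imp_convergent_subsequence by blast
    then have "l \<in> We_op T D"
      unfolding We_op_def We_form_def op_form_def weakly_to_zero_iff_wnull
      using x(1,2) wnull_subseq[OF x(3) s(1)] by (auto simp: o_def intro!: exI[of _ "\<lambda>n. x (s n)"])
    moreover have "Re l = r"
    proof (rule LIMSEQ_unique)
      show "(\<lambda>n. Re (cinner (T (x (s n))) (x (s n)))) \<longlonglongrightarrow> Re l"
        using tendsto_Re[OF s(2)] by (simp add: o_def)
      have "(\<lambda>n. b (x (s n)) (x (s n)) - c) \<longlonglongrightarrow> (r + c) - c"
        by (intro tendsto_diff tendsto_const filterlim_compose[OF x(4) filterlim_subseq[OF s(1)]])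
      then show "(\<lambda>n. Re (cinner (T (x (s n))) (x (s n)))) \<longlonglongrightarrow> r"
        by (simp add: b_self x(2) Re_cinner)
    qed
    ultimately show "r \<in> Re ` We_op T D" by blast
  qed
qed

text \<open>If \<open>R\<close> is the compact resolvent at \<open>l\<close> and \<open>x n\<close> a singular sequence, then \<open>R (x n)\<close> tends to
  zero in the form norm, so \<open>1 = \<langle>(T - l) R (x n), x n\<rangle>\<close> tends to zero as well.\<close>

lemma compact_resolvent_We_op_empty:
  assumes "compact_resolvent T D"
  shows "We_op T D = {}"
proof (rule ccontr)
  assume "We_op T D \<noteq> {}"
  then have "Re ` We_op T D \<noteq> {}" by blast
  then obtain L where "L \<in> We_real (\<lambda>x. b x x) D" unfolding Re_We_op by blast
  then obtain x where x: "\<And>n. x n \<in> D" "\<And>n. norm (x n) = 1" "wnull x"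
      "(\<lambda>n. b (x n) (x n)) \<longlonglongrightarrow> L"
    unfolding We_real_def by blast
  obtain l where l: "l \<in> resolvent_set T D" "compact_op (resolvent T D l)"
    using assms unfolding compact_resolvent_def by blast
  define R where "R = resolvent T D l"
  have bij: "bij_betw (\<lambda>x. T x - scaleC l x) D UNIV" using l(1) by (simp add: resolvent_set_def)
  have RD: "R y \<in> D" and TR: "T (R y) - scaleC l (R y) = y" for y
    using bij_betw_inv_into[OF bij] bij_betw_inv_into_right[OF bij, of y]
    unfolding R_def resolvent_def by (auto simp: bij_betw_def)
  have R_eqI: "R y = z" if "z \<in> D" "T z - scaleC l z = y" for y z
    using bij_betw_inv_into_left[OF bij that(1)] that(2) unfolding R_def resolvent_def by simp
  obtain C where C: "\<And>y. norm (R y) \<le> C * norm y"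
    using l(1) unfolding resolvent_set_def R_def resolvent_def by blast
  have R: "bounded_linear R"
  proof (rule bounded_linear_intro)
    fix y z show "R (y + z) = R y + R z"
    proof (rule R_eqI)
      show "T (R y + R z) - scaleC l (R y + R z) = y + z"
        using RD TR[of y] TR[of z] by (simp add: T_add scaleC_add_right algebra_simps)
    qed (use RD in auto)
  next
    fix r y show "R (r *\<^sub>R y) = r *\<^sub>R R y"
    proof (rule R_eqI)
      have "scaleC l (r *\<^sub>R R y) = r *\<^sub>R scaleC l (R y)"
        by (simp only: scaleC_of_real[symmetric] scaleC_scaleC mult.commute)
      then have "T (r *\<^sub>R R y) - scaleC l (r *\<^sub>R R y) = r *\<^sub>R (T (R y) - scaleC l (R y))"
        using RD by (simp add: T_scaleR scaleR_diff_right)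
      then show "T (r *\<^sub>R R y) - scaleC l (r *\<^sub>R R y) = r *\<^sub>R y" by (simp add: TR)
    qed (use RD in auto)
  next
    fix y show "norm (R y) \<le> norm y * C" using C[of y] by (simp add: mult.commute)
  qed
  have Rw: "wnull (\<lambda>n. R (x n))" unfolding wnull_def
  proof
    fix y
    \<comment> \<open>The Riesz vector obtained from this functional acts as the adjoint of
      \<open>R\<close> applied to \<open>y\<close>.\<close>
    have "bounded_linear (\<lambda>v. inner (R v) y)"
      using bounded_linear_compose[OF bounded_linear_inner_left R] .
    then obtain p where "\<forall>v. inner (R v) y = inner p v" using riesz_bounded_linear by blast
    then show "(\<lambda>n. inner (R (x n)) y) \<longlonglongrightarrow> 0"
      using x(3) by (simp add: wnull_def inner_commute)
  qed
  \<comment> \<open>\<open>compact_op\<close> speaks of the open unit ball, which unit vectors miss;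
    hence the factor 1/2.\<close>
  have "R ((1/2) *\<^sub>R x n) \<in> closure (R ` ball 0 1)" for n
    by (rule subsetD[OF closure_subset]) (use x(2)[of n] in auto)
  then obtain w s where s: "strict_mono (s :: nat \<Rightarrow> nat)"
      "((\<lambda>n. R ((1/2) *\<^sub>R x n)) \<circ> s) \<longlonglongrightarrow> w"
    using l(2) unfolding compact_op_def R_def[symmetric] compact_def by meson
  have "(\<lambda>n. 2 *\<^sub>R ((1/2) *\<^sub>R R (x (s n)))) \<longlonglongrightarrow> 2 *\<^sub>R w"
    using s(2) by (intro tendsto_scaleR tendsto_const)
      (simp add: o_def linear_scale[OF bounded_linear.linear[OF R]])
  then have g: "(\<lambda>n. R (x (s n))) \<longlonglongrightarrow> 2 *\<^sub>R w" by simp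
  \<comment> \<open>A norm limit is also the weak limit, which is zero by \<open>Rw\<close>.\<close>
  have "inner (2 *\<^sub>R w) (2 *\<^sub>R w) = 0"
  proof (rule LIMSEQ_unique)
    show "(\<lambda>n. inner (R (x (s n))) (2 *\<^sub>R w)) \<longlonglongrightarrow> inner (2 *\<^sub>R w) (2 *\<^sub>R w)"
      by (intro tendsto_inner g tendsto_const)
    show "(\<lambda>n. inner (R (x (s n))) (2 *\<^sub>R w)) \<longlonglongrightarrow> 0"
      using wnull_subseq[OF Rw s(1)] by (simp add: wnull_def)
  qed
  then have "2 *\<^sub>R w = 0" by (simp only: inner_eq_zero_iff)
  with g have g0: "(\<lambda>n. norm (R (x (s n)))) \<longlonglongrightarrow> 0" using tendsto_norm_zero by metis
  \<comment> \<open>Replacing \<open>T (R y)\<close> by \<open>y + scaleC l (R y)\<close> bounds the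
    form at \<open>R y\<close> by norms alone, so norm convergence to zero becomes form
    convergence.\<close>
  have bg: "b (R y) (R y) \<le> norm (R y) * norm y + (cmod l + \<bar>c\<bar>) * (norm (R y))\<^sup>2" for y
  proof -
    have "b (R y) (R y) = inner (y + scaleC l (R y)) (R y) + c * (norm (R y))\<^sup>2"
      using TR[of y] by (metis b_self diff_add_cancel)
    also have "\<dots> = inner y (R y) + inner (scaleC l (R y)) (R y) + c * (norm (R y))\<^sup>2"
      by (simp add: inner_add_left)
    also have "inner y (R y) \<le> norm (R y) * norm y"
      using norm_cauchy_schwarz[of y "R y"] by (simp add: mult.commute)
    also have "inner (scaleC l (R y)) (R y) \<le> cmod l * (norm (R y))\<^sup>2"
      using norm_cauchy_schwarz[of "scaleC l (R y)" "R y"]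
      by (simp add: norm_scaleC power2_eq_square)
    also have "c * (norm (R y))\<^sup>2 \<le> \<bar>c\<bar> * (norm (R y))\<^sup>2" by (intro mult_right_mono) auto
    finally show ?thesis by (simp add: algebra_simps)
  qed
  have "(\<lambda>n. norm (R (x (s n))) * 1 + (cmod l + \<bar>c\<bar>) * (norm (R (x (s n))))\<^sup>2)
      \<longlonglongrightarrow> 0 * 1 + (cmod l + \<bar>c\<bar>) * 0\<^sup>2"
    by (intro tendsto_intros g0)
  then have lim: "(\<lambda>n. norm (R (x (s n))) * 1 + (cmod l + \<bar>c\<bar>) * (norm (R (x (s n))))\<^sup>2) \<longlonglongrightarrow> 0"
    by simp
  have "(\<lambda>n. b (R (x (s n))) (R (x (s n)))) \<longlonglongrightarrow> 0"
  proof (rule Lim_null_comparison[OF always_eventually lim], rule allI)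
    fix n
    show "norm (b (R (x (s n))) (R (x (s n))))
        \<le> norm (R (x (s n))) * 1 + (cmod l + \<bar>c\<bar>) * (norm (R (x (s n))))\<^sup>2"
      using bg[of "x (s n)"] B_nonneg[OF RD[of "x (s n)"]] x(2)[of "s n"] by simp
  qed
  from tendsto_real_sqrt[OF this] have nBg: "(\<lambda>n. nB (R (x (s n)))) \<longlonglongrightarrow> 0"
    by (simp add: nB_def)
  have nBx: "(\<lambda>n. nB (x (s n))) \<longlonglongrightarrow> sqrt L"
    unfolding nB_def
    by (intro tendsto_real_sqrt filterlim_compose[OF x(4) filterlim_subseq[OF s(1)]])
  let ?K = "2 * (1 + \<bar>c\<bar> + M)"
  \<comment> \<open>In the product, the form norm of \<open>x (s n)\<close> stays bounded because
    its form values converge, while that of \<open>R (x (s n))\<close> tends to zero.\<close>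
  have le: "1 \<le> ?K * (nB (R (x (s n))) * nB (x (s n))) + cmod l * norm (R (x (s n)))" for n
  proof -
    let ?y = "x (s n)"
    have "1 = cmod (cinner ?y ?y)" using x(2)[of "s n"] by (simp add: cinner_self)
    also have "cinner ?y ?y = cinner (T (R ?y)) ?y - l * cinner (R ?y) ?y"
      using TR[of ?y] by (metis cinner_diff_left cinner_scaleC_left)
    also have "cmod \<dots> \<le> cmod (cinner (T (R ?y)) ?y) + cmod (l * cinner (R ?y) ?y)"
      by (rule norm_triangle_ineq4)
    also have "cmod (cinner (T (R ?y)) ?y) \<le> ?K * (nB (R ?y) * nB ?y)"
      by (rule sesquilinear_bound[OF RD x(1)])
    also have "cmod (l * cinner (R ?y) ?y) \<le> cmod l * norm (R ?y)"
      using norm_cinner_le[of "R ?y" ?y] x(2)[of "s n"] by (simp add: norm_mult mult_left_mono)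
    finally show ?thesis by simp
  qed
  have "(\<lambda>n. ?K * (nB (R (x (s n))) * nB (x (s n))) + cmod l * norm (R (x (s n))))
      \<longlonglongrightarrow> ?K * (0 * sqrt L) + cmod l * 0"
    by (intro tendsto_add tendsto_mult tendsto_const nBg nBx g0)
  then have "1 \<le> ?K * (0 * sqrt L) + cmod l * 0"
    by (rule LIMSEQ_le_const) (use le in blast)
  then show False by simp
qed

end

section \<open>Transfer to the selfadjoint real part when the domain is total\<close>

text \<open>Totality makes the vector chosen in \<open>assoc_op\<close> unique, and uniqueness is
  what makes \<open>A\<close> linear and onto.\<close>

locale total_sectorial_op = sectorial_op +
  assumes total: "(\<And>v. v \<in> D \<Longrightarrow> inner z v = 0) \<Longrightarrow> z = 0"
begin

lemma A_eqI:
  assumes "x \<in> cl.op_dom" "\<And>v. v \<in> clV \<Longrightarrow> clB x v = inner z v"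
  shows "A x = z"
proof -
  have "inner (A x - z) v = 0" if "v \<in> D" for v
  proof -
    have "v \<in> clV" using that V_subset_clV by blast
    then show ?thesis using A_clB[OF assms(1)] assms(2) by (simp add: inner_diff_left)
  qed
  then have "A x - z = 0" by (rule total)
  then show ?thesis by simp
qed

sublocale op: pos_op cl.op_dom A
proof
  note sub = cl.op_dom_subset[THEN subsetD]
  show "subspace cl.op_dom" by (rule cl.subspace_op_dom)
  show "\<exists>x\<in>cl.op_dom. A x = h" for h
    using cl.ex_op_dom[of h] A_eqI by metis
  fix x assume x: "x \<in> cl.op_dom"
  show "(norm x)\<^sup>2 \<le> inner (A x) x"
    using cl.B_coercive[OF sub[OF x]] A_clB[OF x sub[OF x]] by simp
  show "A (r *\<^sub>R x) = r *\<^sub>R A x" for r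
  proof (rule A_eqI)
    show "r *\<^sub>R x \<in> cl.op_dom" by (rule subspace_scale[OF cl.subspace_op_dom x])
    show "clB (r *\<^sub>R x) v = inner (r *\<^sub>R A x) v" if v: "v \<in> clV" for v
      using cl.B_scale_left[OF sub[OF x] v] A_clB[OF x v] by simp
  qed
  fix y assume y: "y \<in> cl.op_dom"
  show "A (x + y) = A x + A y"
  proof (rule A_eqI)
    show "x + y \<in> cl.op_dom" by (rule subspace_add[OF cl.subspace_op_dom x y])
    show "clB (x + y) v = inner (A x + A y) v" if v: "v \<in> clV" for v
      using cl.B_add_left[OF sub[OF x] sub[OF y] v] A_clB[OF x v] A_clB[OF y v]
      by (simp add: inner_add_left)
  qed
  show "inner (A x) y = inner x (A y)"
    using A_clB[OF x sub[OF y]] A_clB[OF y sub[OF x]] cl.B_sym[OF sub[OF x] sub[OF y]]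
    by (simp add: inner_commute)
qed

lemma We_real_eq: "We_real (\<lambda>x. b x x) D = We_real op.Q cl.op_dom"
proof -
  have cong: "We_real f S = We_real g S" if e: "\<And>x. x \<in> S \<Longrightarrow> f x = g x"
    for f g :: "'a \<Rightarrow> real" and S
    unfolding We_real_def by (intro Collect_cong ex_cong1 conj_cong refl) (simp add: e)
  have "We_real (\<lambda>x. b x x) D = We_real (\<lambda>x. clB x x) D" by (rule cong) (simp add: clB_eq_B)
  also have "\<dots> = We_real (\<lambda>x. clB x x) clV"
    by (rule cl.We_real_dense[symmetric]) (use subspace_V V_subset_clV V_dense in auto)
  also have "\<dots> = We_real (\<lambda>x. clB x x) cl.op_dom"
    by (rule cl.We_real_dense)
      (use cl.subspace_op_dom cl.op_dom_subset cl.op_dom_dense in auto)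
  also have "\<dots> = We_real op.Q cl.op_dom"
    by (rule cong) (use A_clB cl.op_dom_subset in \<open>auto simp: op.Q_def\<close>)
  finally show ?thesis .
qed

lemma We_op_ReT:
  "We_op (ReT T D) (ReT_dom T D) = complex_of_real ` {r. r + c \<in> We_real op.Q cl.op_dom}"
proof -
  have iff: "(\<lambda>n. cinner (ReT T D (x n)) (x n)) \<longlonglongrightarrow> l \<longleftrightarrow>
      (\<exists>r. l = complex_of_real r \<and> (\<lambda>n. op.Q (x n)) \<longlonglongrightarrow> r + c)"
    if x: "\<And>n. x n \<in> cl.op_dom" "\<And>n. norm (x n) = 1" for x l
  proof -
    have e: "cinner (ReT T D (x n)) (x n) = complex_of_real (op.Q (x n) - c)" for n
      using ReT_self[OF x(1)[of n]] x(2)[of n] by (simp add: op.Q_def)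
    show ?thesis unfolding e
    proof
      assume a: "(\<lambda>n. complex_of_real (op.Q (x n) - c)) \<longlonglongrightarrow> l"
      have "l = complex_of_real (Re l)"
        using LIMSEQ_unique[OF tendsto_Im[OF a], of 0] by (simp add: complex_eq_iff)
      moreover have "(\<lambda>n. op.Q (x n) - c + c) \<longlonglongrightarrow> Re l + c"
        using tendsto_Re[OF a] by (intro tendsto_add tendsto_const) simp
      ultimately show "\<exists>r. l = complex_of_real r \<and> (\<lambda>n. op.Q (x n)) \<longlonglongrightarrow> r + c"
        by (intro exI[of _ "Re l"]) simp
    next
      assume "\<exists>r. l = complex_of_real r \<and> (\<lambda>n. op.Q (x n)) \<longlonglongrightarrow> r + c"
      then obtain r where r: "l = complex_of_real r" "(\<lambda>n. op.Q (x n)) \<longlonglongrightarrow> r + c" by blast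
      have "(\<lambda>n. complex_of_real (op.Q (x n) - c)) \<longlonglongrightarrow> complex_of_real (r + c - c)"
        by (intro tendsto_of_real tendsto_diff tendsto_const r(2))
      then show "(\<lambda>n. complex_of_real (op.Q (x n) - c)) \<longlonglongrightarrow> l" by (simp add: r(1))
    qed
  qed
  show ?thesis
    unfolding We_op_def We_form_def op_form_def ReT_dom_eq weakly_to_zero_iff_wnull We_real_def
    using iff by (auto simp: image_iff) (metis iff)+
qed

lemma Re_We_op_eq: "complex_of_real ` Re ` We_op T D = We_op (ReT T D) (ReT_dom T D)"
  by (simp only: Re_We_op We_op_ReT We_real_eq)

lemma ess_spec_ReT: "complex_of_real r \<in> ess_spec (ReT T D) (ReT_dom T D) \<longleftrightarrow> r + c \<in> op.ess"
proof -
  have "ReT T D x - scaleC (complex_of_real r) x = A x - (r + c) *\<^sub>R x" for x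
    by (simp add: A_def scaleC_of_real algebra_simps)
  then show ?thesis
    unfolding ess_spec_def op.ess_def ReT_dom_eq weakly_to_zero_iff_wnull by simp
qed

lemma bounded_above_ReT:
  "bounded_above_op (ReT T D) (ReT_dom T D) \<longleftrightarrow> (\<exists>m. \<forall>x\<in>cl.op_dom. op.Q x \<le> m * (norm x)\<^sup>2)"
proof -
  have e: "Re (cinner (ReT T D x) x) = op.Q x - c * (norm x)\<^sup>2" if "x \<in> cl.op_dom" for x
    using ReT_self[OF that] by (simp add: op.Q_def)
  have "bounded_above_op (ReT T D) (ReT_dom T D)
      \<longleftrightarrow> (\<exists>m. \<forall>x\<in>cl.op_dom. op.Q x \<le> (m + c) * (norm x)\<^sup>2)"
    by (simp add: bounded_above_op_def ReT_dom_eq e diff_le_eq distrib_right)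
  also have "\<dots> \<longleftrightarrow> (\<exists>m. \<forall>x\<in>cl.op_dom. op.Q x \<le> m * (norm x)\<^sup>2)"
    by (metis diff_add_cancel)
  finally show ?thesis .
qed

lemma bounded_below_ReT: "bounded_below_op (ReT T D) (ReT_dom T D)"
  unfolding bounded_below_op_def ReT_dom_eq
proof (intro exI[of _ "- c"] ballI)
  fix x assume "x \<in> cl.op_dom"
  then show "- c * (norm x)\<^sup>2 \<le> Re (cinner (ReT T D x) x)"
    using ReT_self[of x] op.Q_nonneg[of x] by (simp add: op.Q_def)
qed

text \<open>The lower bound excludes -infinity, and infinity cannot be the left end below a real
  number; so it occurs only as a right end, exactly when the form is unbounded above.\<close>

lemma We_op_ReT_conv:
  assumes "\<exists>C::'a set. countable C \<and> closure C = UNIV"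
  shows "We_op (ReT T D) (ReT_dom T D) =
    complex_of_real ` {r. ereal r \<in> ereal_conv (ess_spec_hat (ReT T D) (ReT_dom T D))}"
proof -
  let ?S = "{r. r + c \<in> op.ess}"
  define unb where "unb \<longleftrightarrow> (\<forall>m. \<exists>x\<in>cl.op_dom. op.Q x > m * (norm x)\<^sup>2)"
  have above: "bounded_above_op (ReT T D) (ReT_dom T D) \<longleftrightarrow> \<not> unb"
    by (simp add: bounded_above_ReT unb_def not_less)
  have hat: "ess_spec_hat (ReT T D) (ReT_dom T D) = ereal ` ?S \<union> (if unb then {\<infinity>} else {})"
    unfolding ess_spec_hat_def ess_spec_ReT above using bounded_below_ReT by simp
  have "r + c \<in> We_real op.Q cl.op_dom \<longleftrightarrow>
      ereal r \<in> ereal_conv (ess_spec_hat (ReT T D) (ReT_dom T D))" for r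
  proof -
    have "r + c \<in> We_real op.Q cl.op_dom \<longleftrightarrow>
        (\<exists>a\<in>?S. a \<le> r \<and> (unb \<or> (\<exists>b\<in>?S. r \<le> b)))"
    proof -
      have shift: "(\<exists>a\<in>op.ess. P a) \<longleftrightarrow> (\<exists>a\<in>?S. P (a + c))" for P
        by (metis (mono_tags, lifting) diff_add_cancel mem_Collect_eq)
      show ?thesis unfolding op.We_eq_conv_ess[OF assms] unb_def[symmetric] shift by simp
    qed
    also have "\<dots> \<longleftrightarrow> ereal r \<in> ereal_conv (ess_spec_hat (ReT T D) (ReT_dom T D))"
      unfolding hat ereal_conv_def by auto
    finally show ?thesis .
  qed
  then show ?thesis unfolding We_op_ReT by simp
qed

end

section \<open>From m-sectoriality to the form hypotheses\<close>

text \<open>The sector gives the form bounds after normalizing vectors. Totality comes from the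
  resolvent point: a vector orthogonal to \<open>D\<close> is (T - l) x with x in \<open>D\<close>,
  so <T x, x> = l |x|^2, and x = 0 since l avoids the numerical range.\<close>

lemma m_sectorial_imp_total_sectorial_op:
  fixes T :: "'a::complex_inner \<Rightarrow> 'a"
  assumes "m_sectorial T D \<theta>"
  shows "\<exists>c M. total_sectorial_op T D c M"
proof -
  have sec: "sectorial T D \<theta>" using assms by (simp add: m_sectorial_def)
  then have lin: "lin_op T D" and th: "0 \<le> \<theta>" "\<theta> < pi / 2" by (auto simp: sectorial_def)
  obtain \<gamma> where \<gamma>: "\<And>z. z \<in> num_range T D \<Longrightarrow> \<bar>Arg (z - complex_of_real \<gamma>)\<bar> \<le> \<theta>"
    using sec by (auto simp: sectorial_def)
  have cos: "cos \<theta> > 0" using th by (intro cos_gt_zero_pi) auto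
  have csub: "csubspace D" using lin by (simp add: lin_op_def)
  have TC: "T (scaleC a x) = scaleC a (T x)" if "x \<in> D" for a x
    using lin that by (simp add: lin_op_def)
  have unit: "cinner (T x) x / complex_of_real ((norm x)\<^sup>2) \<in> num_range T D"
    if "x \<in> D" "x \<noteq> 0" for x
  proof -
    let ?a = "complex_of_real (1 / norm x)"
    have 1: "scaleC ?a x \<in> D" using csub that by (simp add: csubspace_def)
    have 2: "norm (scaleC ?a x) = 1" using that by (simp add: norm_scaleC norm_divide)
    have "op_form T (scaleC ?a x) (scaleC ?a x) = cinner (T x) x / complex_of_real ((norm x)\<^sup>2)"
      using that by (simp add: op_form_def TC cinner_scaleC_left cinner_scaleC_right
          power2_eq_square)
    from this[symmetric] 1 2 show ?thesis unfolding num_range_def by blast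
  qed
  have sector: "cos \<theta> * \<bar>Im (cinner (T x) x)\<bar> \<le> inner (T x) x - \<gamma> * (norm x)\<^sup>2"
    "0 \<le> inner (T x) x - \<gamma> * (norm x)\<^sup>2" if x: "x \<in> D" for x
  proof -
    have "cos \<theta> * \<bar>Im (cinner (T x) x)\<bar> \<le> inner (T x) x - \<gamma> * (norm x)\<^sup>2
        \<and> 0 \<le> inner (T x) x - \<gamma> * (norm x)\<^sup>2"
    proof (cases "x = 0")
      case True
      then show ?thesis using norm_cinner_le[of "T x" x] by simp
    next
      case False
      define w where "w = cinner (T x) x / complex_of_real ((norm x)\<^sup>2) - complex_of_real \<gamma>"
      have "\<bar>Arg w\<bar> \<le> \<theta>" unfolding w_def by (rule \<gamma>[OF unit[OF x False]])
      then have c: "cos \<theta> \<le> cos (Arg w)"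
        using cos_monotone_0_pi_le[of "\<bar>Arg w\<bar>" \<theta>] th by simp
      \<comment> \<open>This also covers w = 0, where the value of \<open>Arg\<close> is a
        convention but the modulus vanishes.\<close>
      have "Re w = cmod w * cos (Arg w)" by (metis Re_rcis rcis_cmod_Arg)
      then have "cos \<theta> * cmod w \<le> Re w" using c by (metis mult.commute mult_left_mono norm_ge_zero)
      moreover have "cos \<theta> * \<bar>Im w\<bar> \<le> cos \<theta> * cmod w"
        using cos abs_Im_le_cmod by (intro mult_left_mono) auto
      moreover have "0 \<le> cos \<theta> * \<bar>Im w\<bar>" using cos by simp
      ultimately have w: "cos \<theta> * \<bar>Im w\<bar> \<le> Re w" "0 \<le> Re w" by linarith+
      have n: "(norm x)\<^sup>2 > 0" using False by simp
      have Re: "Re w * (norm x)\<^sup>2 = inner (T x) x - \<gamma> * (norm x)\<^sup>2"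
        using n by (simp add: w_def Re_cinner left_diff_distrib flip: of_real_power)
      have Im: "\<bar>Im w\<bar> * (norm x)\<^sup>2 = \<bar>Im (cinner (T x) x)\<bar>"
        using n by (simp add: w_def flip: of_real_power)
      have "cos \<theta> * \<bar>Im w\<bar> * (norm x)\<^sup>2 \<le> Re w * (norm x)\<^sup>2" "0 \<le> Re w * (norm x)\<^sup>2"
        using w by (auto intro: mult_right_mono)
      then show ?thesis unfolding Re by (simp add: mult.assoc Im)
    qed
    then show "cos \<theta> * \<bar>Im (cinner (T x) x)\<bar> \<le> inner (T x) x - \<gamma> * (norm x)\<^sup>2"
      "0 \<le> inner (T x) x - \<gamma> * (norm x)\<^sup>2" by blast+
  qed
  \<comment> \<open>Moving the vertex \<gamma> to zero only gives nonnegativity; the extra one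
    yields the squared norm. The constant 1 / cos \<theta> is a cruder but simpler bound than the
    tangent.\<close>
  have "total_sectorial_op T D (1 - \<gamma>) (1 / cos \<theta>)"
  proof
    show "lin_op T D" by fact
    show "0 \<le> 1 / cos \<theta>" using cos by simp
    fix x assume x: "x \<in> D"
    show "(norm x)\<^sup>2 \<le> inner (T x) x + (1 - \<gamma>) * (norm x)\<^sup>2"
      using sector(2)[OF x] by (simp add: algebra_simps)
    have "cos \<theta> * \<bar>Im (cinner (T x) x)\<bar> \<le> inner (T x) x + (1 - \<gamma>) * (norm x)\<^sup>2"
      using sector(1)[OF x] zero_le_power2[of "norm x"] unfolding left_diff_distrib by linarith
    then show "\<bar>Im (cinner (T x) x)\<bar> \<le> 1 / cos \<theta> * (inner (T x) x + (1 - \<gamma>) * (norm x)\<^sup>2)"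
      using cos by (simp add: field_simps)
  next
    fix z assume z: "\<And>v. v \<in> D \<Longrightarrow> inner z v = 0"
    obtain l where l: "l \<notin> closure (num_range T D)" "l \<in> resolvent_set T D"
      using assms by (auto simp: m_sectorial_def)
    have bij: "bij_betw (\<lambda>x. T x - scaleC l x) D UNIV" using l(2) by (simp add: resolvent_set_def)
    then have "z \<in> (\<lambda>x. T x - scaleC l x) ` D" by (simp add: bij_betw_def)
    then obtain x where x: "x \<in> D" "z = T x - scaleC l x" by blast
    have "cinner z x = 0"
      using z x(1) csub by (simp add: complex_eq_iff Re_cinner Im_cinner csubspace_def)
    then have e: "cinner (T x) x = l * complex_of_real ((norm x)\<^sup>2)"
      unfolding x(2) cinner_diff_left cinner_scaleC_left cinner_self by simp
    have "x = 0"
    proof (rule ccontr)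
      assume "x \<noteq> 0"
      then have "l \<in> num_range T D" using unit[OF x(1)] e by simp
      then show False using l(1) closure_subset by blast
    qed
    have null: "scaleC 0 y = 0" "scaleC a 0 = (0::'a)" for a and y :: 'a
      using norm_scaleC[of 0 y] norm_scaleC[of a "0::'a"] by auto
    then have "T 0 = 0" using TC[OF x(1), of 0] by simp
    then show "z = 0" using x(2) \<open>x = 0\<close> null by simp
  qed
  then show ?thesis by blast
qed

section \<open>Inclusions for arbitrary operators, and assembly of both parts\<close>

lemma Re_We_op_subset: "complex_of_real ` Re ` We_op T D \<subseteq> We_form (Re_form (op_form T)) D"
proof
  fix z assume "z \<in> complex_of_real ` Re ` We_op T D"
  then obtain l x where z: "z = complex_of_real (Re l)"
    and x: "\<forall>n. x n \<in> D \<and> norm (x n) = 1" "weakly_to_zero x" "(\<lambda>n. op_form T (x n) (x n)) \<longlonglongrightarrow> l"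
    unfolding We_op_def We_form_def by blast
  have "Re_form (op_form T) y y = complex_of_real (Re (op_form T y y))" for y
    by (simp add: Re_form_def adj_form_def complex_eq_iff)
  then have "(\<lambda>n. Re_form (op_form T) (x n) (x n)) \<longlonglongrightarrow> z"
    unfolding z by (simp add: tendsto_of_real tendsto_Re x(3))
  with x(1,2) show "z \<in> We_form (Re_form (op_form T)) D" unfolding We_form_def by blast
qed

lemma Im_We_op_subset: "complex_of_real ` Im ` We_op T D \<subseteq> We_form (Im_form (op_form T)) D"
proof
  fix z assume "z \<in> complex_of_real ` Im ` We_op T D"
  then obtain l x where z: "z = complex_of_real (Im l)"
    and x: "\<forall>n. x n \<in> D \<and> norm (x n) = 1" "weakly_to_zero x" "(\<lambda>n. op_form T (x n) (x n)) \<longlonglongrightarrow> l"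
    unfolding We_op_def We_form_def by blast
  have "Im_form (op_form T) y y = complex_of_real (Im (op_form T y y))" for y
    by (simp add: Im_form_def adj_form_def complex_eq_iff Re_divide Im_divide power2_eq_square)
  then have "(\<lambda>n. Im_form (op_form T) (x n) (x n)) \<longlonglongrightarrow> z"
    unfolding z by (simp add: tendsto_of_real tendsto_Im x(3))
  with x(1,2) show "z \<in> We_form (Im_form (op_form T)) D" unfolding We_form_def by blast
qed

theorem theorem3p10:
  fixes T :: "'a::complex_inner \<Rightarrow> 'a" and D :: "'a set"
  assumes sep: "separable_space TYPE('a)"
    and infdim: "infinite_dimensional TYPE('a)"
    and lin: "lin_op T D"
  shows "(complex_of_real ` Re ` We_op T D \<subseteq> We_form (Re_form (op_form T)) D
       \<and> complex_of_real ` Im ` We_op T D \<subseteq> We_form (Im_form (op_form T)) D)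
       \<and> (\<forall>\<theta>. m_sectorial T D \<theta> \<longrightarrow>
          complex_of_real ` Re ` We_op T D = We_op (ReT T D) (ReT_dom T D)
        \<and> We_op (ReT T D) (ReT_dom T D)
            = complex_of_real ` {r. ereal r \<in> ereal_conv (ess_spec_hat (ReT T D) (ReT_dom T D))}
        \<and> (compact_resolvent T D \<longrightarrow> We_op T D = {}))"
proof (intro conjI allI impI Re_We_op_subset Im_We_op_subset)
  fix \<theta> assume "m_sectorial T D \<theta>"
  then obtain c M where "total_sectorial_op T D c M"
    using m_sectorial_imp_total_sectorial_op by blast
  then interpret total_sectorial_op T D c M .
  show "complex_of_real ` Re ` We_op T D = We_op (ReT T D) (ReT_dom T D)"
    by (rule Re_We_op_eq)
  show "We_op (ReT T D) (ReT_dom T D)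
      = complex_of_real ` {r. ereal r \<in> ereal_conv (ess_spec_hat (ReT T D) (ReT_dom T D))}"
    using sep unfolding separable_space_def by (rule We_op_ReT_conv)
  show "We_op T D = {}" if "compact_resolvent T D"
    using that by (rule compact_resolvent_We_op_empty)
qed

end
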